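(* Consider Gaussian noise and $\alpha=2$ in the definition of $\Phi_{\rm o}$. For any integers $s,d$ with $2\le s\le d$ and any $\sigma>0$ (and any $t_0\in\mathbb{R}$ and any $\eta\in\mathbb{R}^d$ with $|\eta_1|\ge\cdots\ge|\eta_d|>0$), the minimax separation rate for testing $H_0:\theta\in\Theta_{s,0}$ against $H_1:\theta\in\Theta_s(\rho)$ is $$r_{\min}=\sigma\sqrt{\Phi_{\rm o}(s;\eta)}.$$ That is: (i) for any $\varepsilon\in(0,1)$ there exists $A_\varepsilon>0$ such that $\mathcal R_s(A\,r_{\min})\le\varepsilon$ for all $A>A_\varepsilon$; (ii) for any $\varepsilon\in(0,1)$ there exists $a_\varepsilon>0$ such that $\mathcal R_s(A\,r_{\min})\ge1-\varepsilon$ for all $0<A<a_\varepsilon$; where $A_\varepsilon$ and $a_\varepsilon$ depend only on $\varepsilon$ (not on $s,d,\eta,\sigma,t_0$).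
   Context: Model: $\eta\in\mathbb{R}^d$ is known with $|\eta_1|\ge\cdots\ge|\eta_d|>0$; one observes $y_j=\theta_j+\sigma\xi_j$, $j=1,\dots,d$, with $\theta\in\mathbb{R}^d$ unknown, $\sigma>0$ known, and $\xi_1,\dots,\xi_d$ i.i.d. $\mathcal N(0,1)$; $\mathbb{P}_\theta$ denotes the law of $(y_1,\dots,y_d)$. $L(\theta)=\sum_{j=1}^d\eta_j\theta_j$, $\Theta_s=\{\theta\in\mathbb{R}^d:\#\{j:\theta_j\ne0\}\le s\}$. For $t_0\in\mathbb{R}$ and $\rho>0$, $$\Theta_{s,0}=\{\theta\in\Theta_s:L(\theta)=t_0\},\qquad \Theta_s(\rho)=\{\theta\in\Theta_s:|L(\theta)-t_0|\ge\rho\}.$$ The minimax risk of testing is $$\mathcal R_s(\rho)=\inf_\Delta\Big\{\sup_{\theta\in\Theta_{s,0}}\mathbb{P}_\theta(\Delta=1)+\sup_{\theta\in\Theta_s(\rho)}\mathbb{P}_\theta(\Delta=0)\Big\},$$ the infimum being over all measurable $\{0,1\}$-valued functions $\Delta$ of $(y_1,\dots,y_d)$. Rate (with $\alpha=2$): $\beta\in\mathbb{R}$ is the unique solution of $\sum_{j=1}^d|\eta_j|e^{-\beta/\eta_j^2}\big/\sqrt{\sum_{j=1}^d\eta_j^2e^{-\beta/\eta_j^2}}=s/2$; $\lambda_o=\sqrt{\max(\beta,0)}$, $\nu=\sqrt{\sum_{j=1}^d\eta_j^2\exp(-\lambda_o^2/\eta_j^2)}$, $\Phi_{\rm o}(s;\eta)=(\lambda_os+\nu)^2$.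 *)

theory Defs
  imports "HOL-Probability.Probability"
begin

text \<open>
  Since the constants of the result must not depend on the dimension \<open>d\<close>, a vector of
  \<open>\<real>\<^sup>d\<close> is a function on \<open>{1..d}\<close>, extended by \<open>undefined\<close> outside this set.
\<close>

definition vecs :: "nat \<Rightarrow> (nat \<Rightarrow> real) set" where
  "vecs d = ({1..d} \<rightarrow>\<^sub>E UNIV)"

definition L :: "nat \<Rightarrow> (nat \<Rightarrow> real) \<Rightarrow> (nat \<Rightarrow> real) \<Rightarrow> real" where
  "L d \<eta> \<theta> = (\<Sum>j=1..d. \<eta> j * \<theta> j)"

definition Theta :: "nat \<Rightarrow> nat \<Rightarrow> (nat \<Rightarrow> real) set" where
  "Theta d s = {\<theta> \<in> vecs d. card {j \<in> {1..d}. \<theta> j \<noteq> 0} \<le> s}"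

definition Theta_null :: "nat \<Rightarrow> nat \<Rightarrow> (nat \<Rightarrow> real) \<Rightarrow> real \<Rightarrow> (nat \<Rightarrow> real) set" where
  "Theta_null d s \<eta> t0 = {\<theta> \<in> Theta d s. L d \<eta> \<theta> = t0}"

definition Theta_alt ::
    "nat \<Rightarrow> nat \<Rightarrow> (nat \<Rightarrow> real) \<Rightarrow> real \<Rightarrow> real \<Rightarrow> (nat \<Rightarrow> real) set" where
  "Theta_alt d s \<eta> t0 \<rho> = {\<theta> \<in> Theta d s. \<bar>L d \<eta> \<theta> - t0\<bar> \<ge> \<rho>}"

definition obs_space :: "nat \<Rightarrow> (nat \<Rightarrow> real) measure" where
  "obs_space d = (\<Pi>\<^sub>M j\<in>{1..d}. borel)"

definition noise :: "nat \<Rightarrow> (nat \<Rightarrow> real) measure" where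
  "noise d = (\<Pi>\<^sub>M j\<in>{1..d}. density lborel std_normal_density)"

definition obs_law :: "nat \<Rightarrow> real \<Rightarrow> (nat \<Rightarrow> real) \<Rightarrow> (nat \<Rightarrow> real) measure" where
  "obs_law d \<sigma> \<theta> =
     distr (noise d) (obs_space d) (\<lambda>\<xi>. \<lambda>j\<in>{1..d}. \<theta> j + \<sigma> * \<xi> j)"

definition tests :: "nat \<Rightarrow> ((nat \<Rightarrow> real) \<Rightarrow> nat) set" where
  "tests d = measurable (obs_space d) (count_space {0, 1})"

text \<open>
  The suprema and the infimum below are taken in the conditionally complete type \<^typ>\<open>real\<close>.
  This is harmless: all values lie in \<open>[0, 2]\<close>, and both parameter sets are nonempty
  as soon as \<open>s \<ge> 1\<close>, \<open>d \<ge> 1\<close> and \<open>\<eta> 1 \<noteq> 0\<close>.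
\<close>

definition minimax_risk ::
    "nat \<Rightarrow> nat \<Rightarrow> (nat \<Rightarrow> real) \<Rightarrow> real \<Rightarrow> real \<Rightarrow> real \<Rightarrow> real" where
  "minimax_risk d s \<eta> \<sigma> t0 \<rho> =
     (INF \<Delta>\<in>tests d.
        (SUP \<theta>\<in>Theta_null d s \<eta> t0.
           measure (obs_law d \<sigma> \<theta>) {y \<in> space (obs_law d \<sigma> \<theta>). \<Delta> y = 1}) +
        (SUP \<theta>\<in>Theta_alt d s \<eta> t0 \<rho>.
           measure (obs_law d \<sigma> \<theta>) {y \<in> space (obs_law d \<sigma> \<theta>). \<Delta> y = 0}))"

text \<open>
  The left-hand side of the equation is continuous and strictly decreasing in \<open>b\<close>, with
  limits \<open>\<infinity>\<close> and \<open>0\<close>, whenever \<open>d \<ge> 1\<close> and all \<open>\<eta> j\<close> are nonzero, so that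
  the definite description below denotes the solution for every \<open>s \<ge> 1\<close>.
\<close>

definition beta :: "nat \<Rightarrow> nat \<Rightarrow> (nat \<Rightarrow> real) \<Rightarrow> real" where
  "beta d s \<eta> =
     (THE b. (\<Sum>j=1..d. \<bar>\<eta> j\<bar> * exp (- b / (\<eta> j)\<^sup>2)) /
             sqrt (\<Sum>j=1..d. (\<eta> j)\<^sup>2 * exp (- b / (\<eta> j)\<^sup>2)) = real s / 2)"

definition lambda_o :: "nat \<Rightarrow> nat \<Rightarrow> (nat \<Rightarrow> real) \<Rightarrow> real" where
  "lambda_o d s \<eta> = sqrt (max (beta d s \<eta>) 0)"

definition nu :: "nat \<Rightarrow> nat \<Rightarrow> (nat \<Rightarrow> real) \<Rightarrow> real" where
  "nu d s \<eta> = sqrt (\<Sum>j=1..d. (\<eta> j)\<^sup>2 * exp (- (lambda_o d s \<eta>)\<^sup>2 / (\<eta> j)\<^sup>2))"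

definition Phi_o :: "nat \<Rightarrow> nat \<Rightarrow> (nat \<Rightarrow> real) \<Rightarrow> real" where
  "Phi_o d s \<eta> = (lambda_o d s \<eta> * real s + nu d s \<eta>)\<^sup>2"

definition r_min :: "nat \<Rightarrow> nat \<Rightarrow> (nat \<Rightarrow> real) \<Rightarrow> real \<Rightarrow> real" where
  "r_min d s \<eta> \<sigma> = \<sigma> * sqrt (Phi_o d s \<eta>)"

definition admissible :: "nat \<Rightarrow> nat \<Rightarrow> (nat \<Rightarrow> real) \<Rightarrow> real \<Rightarrow> bool" where
  "admissible d s \<eta> \<sigma> \<longleftrightarrow>
     2 \<le> s \<and> s \<le> d \<and> 0 < \<sigma> \<and>
     (\<forall>i\<in>{1..d}. \<forall>j\<in>{1..d}. i \<le> j \<longrightarrow> \<bar>\<eta> i\<bar> \<ge> \<bar>\<eta> j\<bar>) \<and> \<bar>\<eta> d\<bar> > 0"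

end

theory Submission
  imports Defs
begin

text \<open>
  Upper bound: hard thresholding of \<open>y\<^sub>j\<close> at \<open>2\<sigma>\<lambda>\<^sub>o/|\<eta>\<^sub>j|\<close>, so that every coordinate contributes the same
  bias \<open>2\<sigma>\<lambda>\<^sub>o\<close> to the plug-in estimator of \<open>L(\<theta>)\<close>. Off the support of \<open>\<theta>\<close> the surviving noise is
  centred with variance of order \<open>\<sigma>\<^sup>2\<nu>\<^sup>2\<close>; on the support the noise has variance at most
  \<open>\<sigma>\<^sup>2(s\<lambda>\<^sub>o\<^sup>2 + 3\<nu>\<^sup>2)\<close>, and Chebyshev's inequality suffices.

  Lower bound: the second moment method for a mixture of spikes \<open>\<theta>\<^sub>j = \<sigma> sgn(\<eta>\<^sub>j) \<gamma>\<^sub>j\<close>, \<open>j \<in> B\<close>, added to a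
  null parameter carried by the first coordinate. With \<open>p\<^sub>j = |\<eta>\<^sub>j| exp(-\<lambda>\<^sub>o\<^sup>2/\<eta>\<^sub>j\<^sup>2)/\<nu>\<close> the equation for \<open>\<beta>\<close>
  gives \<open>\<Sum> p\<^sub>j \<le> s/2\<close> (with equality when \<open>\<lambda>\<^sub>o > 0\<close>), and \<open>\<Sum> p\<^sub>j\<^sup>2 exp(\<lambda>\<^sub>o\<^sup>2/\<eta>\<^sub>j\<^sup>2) = 1\<close>,
  \<open>\<Sum> p\<^sub>j |\<eta>\<^sub>j| = \<nu>\<close>. A support \<open>B\<close> containing each \<open>j\<close> independently with probability a small multiple
  of \<open>p\<^sub>j\<close> is thus indistinguishable from the null and, by exponential moment bounds, has fewer than
  \<open>s\<close> elements and a large value of \<open>L\<close> with high probability. When \<open>L\<close> does not concentrate, that is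
  when \<open>s\<close> is bounded or \<open>|\<eta>\<^sub>1|\<close> is comparable to \<open>\<nu>\<close>, a single spike is enough.
\<close>

subsection \<open>Gaussian shifts\<close>

abbreviation std_normal :: "real measure" where
  "std_normal \<equiv> density lborel std_normal_density"

lemma prob_space_std_normal: "prob_space std_normal"
  by (rule prob_space_normal_density) simp

lemma product_prob_space_std_normal: "product_prob_space (\<lambda>_::nat. std_normal)"
  by (intro product_prob_spaceI prob_space_std_normal)

lemma product_sigma_finite_std_normal: "product_sigma_finite (\<lambda>_::nat. std_normal)"
  using product_prob_space_std_normal by (simp add: product_prob_space_def)

lemma sets_noise [measurable_cong]: "sets (noise d) = sets (obs_space d)"
  unfolding noise_def obs_space_def by (intro sets_PiM_cong) auto

lemma prob_space_noise: "prob_space (noise d)"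
  unfolding noise_def by (intro prob_space_PiM prob_space_std_normal)

text \<open>Cameron-Martin formula in dimension one: completing the square in the density of N(v, 1)
  leaves the factor exp(v x - v^2/2) on the density of N(0, 1).\<close>

lemma distr_std_normal_shift:
  "distr std_normal borel (\<lambda>x. v + x) = density std_normal (\<lambda>x. ennreal (exp (v * x - v\<^sup>2 / 2)))"
proof -
  interpret prob_space std_normal by (rule prob_space_std_normal)
  have "distributed std_normal lborel (\<lambda>x. x) (\<lambda>x. ennreal (normal_density 0 1 x))"
    unfolding distributed_def by (auto simp: distr_id2)
  from normal_density_affine[OF this, of 1 v]
  have "distributed std_normal lborel (\<lambda>x. v + x) (\<lambda>x. ennreal (normal_density v 1 x))"
    by simp
  then have "distr std_normal lborel (\<lambda>x. v + x) = density lborel (\<lambda>x. ennreal (normal_density v 1 x))"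
    by (simp add: distributed_def)
  moreover have "distr std_normal lborel (\<lambda>x. v + x) = distr std_normal borel (\<lambda>x. v + x)"
    by (intro distr_cong) auto
  moreover have "density lborel (\<lambda>x. ennreal (normal_density v 1 x)) =
      density std_normal (\<lambda>x. ennreal (exp (v * x - v\<^sup>2 / 2)))"
  proof (subst density_density_eq)
    have "normal_density v 1 x = normal_density 0 1 x * exp (v * x - v\<^sup>2 / 2)" for x
      by (simp add: normal_density_def exp_add[symmetric] power2_eq_square field_simps)
    then show "density lborel (\<lambda>x. ennreal (normal_density v 1 x)) =
      density lborel (\<lambda>x. ennreal (normal_density 0 1 x) * ennreal (exp (v * x - v\<^sup>2 / 2)))"
      by (simp add: ennreal_mult)
  qed auto
  ultimately show ?thesis by simp
qed

text \<open>Likelihood ratio of N(v, I) against N(0, I) on the coordinates 1..d.\<close>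

definition tilt :: "nat \<Rightarrow> (nat \<Rightarrow> real) \<Rightarrow> (nat \<Rightarrow> real) \<Rightarrow> real" where
  "tilt d v \<xi> = (\<Prod>j=1..d. exp (v j * \<xi> j - (v j)\<^sup>2 / 2))"

lemma tilt_pos: "tilt d v \<xi> > 0"
  unfolding tilt_def by (intro prod_pos) auto

lemma measurable_tilt [measurable]: "tilt d v \<in> borel_measurable (noise d)"
  unfolding tilt_def noise_def by measurable

text \<open>A measure on the product space is determined by its values on boxes. There both sides
  factor over the coordinates, and each factor is the one-dimensional formula.\<close>

lemma distr_noise_shift:
  "distr (noise d) (obs_space d) (\<lambda>\<xi>. \<lambda>j\<in>{1..d}. v j + \<xi> j) = density (noise d) (\<lambda>\<xi>. ennreal (tilt d v \<xi>))"
proof -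
  let ?M = "\<lambda>j. density std_normal (\<lambda>x. ennreal (exp (v j * x - (v j)\<^sup>2 / 2)))"
  interpret N: product_sigma_finite "\<lambda>_::nat. std_normal" by (rule product_sigma_finite_std_normal)
  have ps: "prob_space (?M j)" for j
    unfolding distr_std_normal_shift[symmetric]
    by (intro prob_space.prob_space_distr prob_space_std_normal) auto
  interpret product_prob_space ?M by (intro product_prob_spaceI ps)
  have "distr (noise d) (obs_space d) (\<lambda>\<xi>. \<lambda>j\<in>{1..d}. v j + \<xi> j) = PiM {1..d} ?M"
  proof (rule PiM_eqI)
    fix A :: "nat \<Rightarrow> real set" assume A: "\<And>i. i \<in> {1..d} \<Longrightarrow> A i \<in> sets (?M i)"
    then have A': "\<And>i. i \<in> {1..d} \<Longrightarrow> A i \<in> sets borel" by simp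
    have "emeasure (distr (noise d) (obs_space d) (\<lambda>\<xi>. \<lambda>j\<in>{1..d}. v j + \<xi> j)) (Pi\<^sub>E {1..d} A)
      = emeasure (noise d) ((\<lambda>\<xi>. \<lambda>j\<in>{1..d}. v j + \<xi> j) -` Pi\<^sub>E {1..d} A \<inter> space (noise d))"
      by (intro emeasure_distr) (auto simp: obs_space_def noise_def intro!: sets_PiM_I_finite A')
    also have "(\<lambda>\<xi>. \<lambda>j\<in>{1..d}. v j + \<xi> j) -` Pi\<^sub>E {1..d} A \<inter> space (noise d) =
       Pi\<^sub>E {1..d} (\<lambda>j. (\<lambda>x. v j + x) -` A j)"
      by (auto simp: noise_def space_PiM PiE_iff extensional_def)
    also have "emeasure (noise d) \<dots> = (\<Prod>j=1..d. emeasure std_normal ((\<lambda>x. v j + x) -` A j))"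
      unfolding noise_def
      by (intro N.emeasure_PiM) (auto intro!: measurable_sets_borel[OF _ A'])
    also have "\<dots> = (\<Prod>j=1..d. emeasure (?M j) (A j))"
      by (intro prod.cong) (auto simp: distr_std_normal_shift[symmetric] emeasure_distr A')
    finally show "emeasure (distr (noise d) (obs_space d) (\<lambda>\<xi>. \<lambda>j\<in>{1..d}. v j + \<xi> j)) (Pi\<^sub>E {1..d} A)
       = (\<Prod>j=1..d. emeasure (?M j) (A j))" .
  qed (auto simp: obs_space_def intro!: sets_PiM_cong)
  also have "\<dots> = density (noise d) (\<lambda>\<xi>. ennreal (tilt d v \<xi>))"
  proof (rule PiM_eqI[symmetric])
    fix A :: "nat \<Rightarrow> real set" assume A: "\<And>i. i \<in> {1..d} \<Longrightarrow> A i \<in> sets (?M i)"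
    then have A': "\<And>i. i \<in> {1..d} \<Longrightarrow> A i \<in> sets borel" by simp
    have "emeasure (density (noise d) (\<lambda>\<xi>. ennreal (tilt d v \<xi>))) (Pi\<^sub>E {1..d} A) =
       (\<integral>\<^sup>+\<xi>. ennreal (tilt d v \<xi>) * indicator (Pi\<^sub>E {1..d} A) \<xi> \<partial>noise d)"
    proof (rule emeasure_density)
      show "Pi\<^sub>E {1..d} A \<in> sets (noise d)"
        unfolding noise_def by (intro sets_PiM_I_finite) (auto intro: A')
    qed measurable
    also have "\<dots> = (\<integral>\<^sup>+\<xi>. (\<Prod>j=1..d. ennreal (exp (v j * \<xi> j - (v j)\<^sup>2 / 2)) * indicator (A j) (\<xi> j)) \<partial>noise d)"
    proof (intro nn_integral_cong)
      fix \<xi> assume "\<xi> \<in> space (noise d)"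
      \<comment> \<open>Points of the product space are \<open>undefined\<close> off {1..d}, so the
        coordinates alone decide whether a point lies in the box.\<close>
      then have "\<xi> \<in> extensional {1..d}" by (simp add: noise_def space_PiM PiE_def)
      then have "indicator (Pi\<^sub>E {1..d} A) \<xi> = (\<Prod>j=1..d. indicator (A j) (\<xi> j) :: ennreal)"
        by (auto simp: indicator_def PiE_def Pi_def prod_zero_iff split: if_splits)
      then show "ennreal (tilt d v \<xi>) * indicator (Pi\<^sub>E {1..d} A) \<xi> =
         (\<Prod>j=1..d. ennreal (exp (v j * \<xi> j - (v j)\<^sup>2 / 2)) * indicator (A j) (\<xi> j))"
        by (simp add: tilt_def prod.distrib prod_ennreal)
    qed
    also have "\<dots> = (\<Prod>j=1..d. \<integral>\<^sup>+x. ennreal (exp (v j * x - (v j)\<^sup>2 / 2)) * indicator (A j) x \<partial>std_normal)"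
      unfolding noise_def using A' by (intro N.product_nn_integral_prod) auto
    also have "\<dots> = (\<Prod>j=1..d. emeasure (?M j) (A j))"
      by (intro prod.cong refl emeasure_density[symmetric]) (auto simp: A')
    finally show "emeasure (density (noise d) (\<lambda>\<xi>. ennreal (tilt d v \<xi>))) (Pi\<^sub>E {1..d} A)
       = (\<Prod>j=1..d. emeasure (?M j) (A j))" .
  qed (auto simp: noise_def intro!: sets_PiM_cong)
  finally show ?thesis .
qed

text \<open>The tilt is the density of a probability measure, the law of the shifted noise.\<close>

lemma integrable_tilt: "integrable (noise d) (tilt d v)"
  and integral_tilt: "(\<integral>\<xi>. tilt d v \<xi> \<partial>noise d) = 1"
proof -
  have "prob_space (distr (noise d) (obs_space d) (\<lambda>\<xi>. \<lambda>j\<in>{1..d}. v j + \<xi> j))"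
    by (intro prob_space.prob_space_distr prob_space_noise) (auto simp: obs_space_def noise_def)
  then have "prob_space (density (noise d) (\<lambda>\<xi>. ennreal (tilt d v \<xi>)))"
    by (simp only: distr_noise_shift)
  from prob_space.emeasure_space_1[OF this]
  have *: "(\<integral>\<^sup>+\<xi>. ennreal (tilt d v \<xi>) \<partial>noise d) = 1"
    by (simp add: emeasure_density cong: nn_integral_cong)
  show "integrable (noise d) (tilt d v)"
    by (rule integrableI_nonneg) (auto simp: * tilt_pos less_imp_le)
  show "(\<integral>\<xi>. tilt d v \<xi> \<partial>noise d) = 1"
    using * by (subst integral_eq_nn_integral) (auto simp: tilt_pos less_imp_le)
qed

text \<open>Expand (u + v)^2 in every coordinate. As tilts integrate to 1, the mixed moment of two
  likelihood ratios is thus the exponential of the inner product of their shifts.\<close>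

lemma tilt_mult:
  "tilt d u \<xi> * tilt d v \<xi> = exp (\<Sum>j=1..d. u j * v j) * tilt d (\<lambda>j. u j + v j) \<xi>"
  unfolding tilt_def exp_sum[OF finite_atLeastAtMost] prod.distrib[symmetric]
  by (intro prod.cong refl) (simp add: exp_add[symmetric] power2_eq_square algebra_simps add_divide_distrib)

section \<open>The law of the observations and its change of measure\<close>

lemma measurable_observation:
  "(\<lambda>\<xi>. \<lambda>j\<in>{1..d}. \<theta> j + \<sigma> * \<xi> j) \<in> measurable (noise d) (obs_space d)"
  unfolding noise_def obs_space_def by measurable

lemma prob_space_obs_law: "prob_space (obs_law d \<sigma> \<theta>)"
  unfolding obs_law_def by (intro prob_space.prob_space_distr prob_space_noise measurable_observation)

lemma measure_obs_law:
  assumes E: "E \<in> sets (obs_space d)"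
  shows "measure (obs_law d \<sigma> \<theta>) E = measure (noise d) {\<xi> \<in> space (noise d). (\<lambda>j\<in>{1..d}. \<theta> j + \<sigma> * \<xi> j) \<in> E}"
  unfolding obs_law_def
  by (subst measure_distr[OF measurable_observation E]) (simp add: vimage_def Int_def conj_commute)

text \<open>Recentring at \<open>\<theta>'\<close> shifts the noise by (\<theta> -
  \<theta>')/\<sigma>. Laws with different parameters become integrals of one indicator against the
  same noise, weighted by a likelihood ratio.\<close>

lemma measure_obs_law_shift:
  assumes E: "E \<in> sets (obs_space d)" and \<sigma>: "\<sigma> > 0"
  shows "measure (obs_law d \<sigma> \<theta>) E =
    (\<integral>\<xi>. tilt d (\<lambda>j. (\<theta> j - \<theta>' j) / \<sigma>) \<xi> * indicator E (\<lambda>j\<in>{1..d}. \<theta>' j + \<sigma> * \<xi> j) \<partial>noise d)"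
proof -
  let ?v = "\<lambda>j. (\<theta> j - \<theta>' j) / \<sigma>"
  let ?F = "{\<xi> \<in> space (noise d). (\<lambda>j\<in>{1..d}. \<theta>' j + \<sigma> * \<xi> j) \<in> E}"
  have F: "?F \<in> sets (noise d)"
    using measurable_sets[OF measurable_observation E] by (simp add: vimage_def Int_def conj_commute)
  have "measure (obs_law d \<sigma> \<theta>) E = measure (noise d) {\<xi> \<in> space (noise d). (\<lambda>j\<in>{1..d}. ?v j + \<xi> j) \<in> ?F}"
  proof -
    have "(\<lambda>j\<in>{1..d}. ?v j + \<xi> j) \<in> ?F \<longleftrightarrow> (\<lambda>j\<in>{1..d}. \<theta> j + \<sigma> * \<xi> j) \<in> E" for \<xi>
    proof -
      have "(\<lambda>j\<in>{1..d}. \<theta>' j + \<sigma> * (\<lambda>j\<in>{1..d}. ?v j + \<xi> j) j) = (\<lambda>j\<in>{1..d}. \<theta> j + \<sigma> * \<xi> j)"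
        using \<sigma> by (intro restrict_ext) (simp add: field_simps)
      then show ?thesis by (simp add: noise_def space_PiM)
    qed
    then show ?thesis unfolding measure_obs_law[OF E] by simp
  qed
  also have "\<dots> = measure (distr (noise d) (obs_space d) (\<lambda>\<xi>. \<lambda>j\<in>{1..d}. ?v j + \<xi> j)) ?F"
    using measurable_observation[of "?v" 1] F
    by (subst measure_distr) (auto simp: sets_noise vimage_def Int_def conj_commute simp del: One_nat_def)
  also have "\<dots> = measure (density (noise d) (\<lambda>\<xi>. ennreal (tilt d ?v \<xi>))) ?F"
    by (simp only: distr_noise_shift)
  also have "\<dots> = (\<integral>\<xi>. tilt d ?v \<xi> * indicator ?F \<xi> \<partial>noise d)"
  proof -
    have "measure (density (noise d) (\<lambda>\<xi>. ennreal (tilt d ?v \<xi>))) ?F =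
      (\<integral>\<xi>. indicator ?F \<xi> \<partial>density (noise d) (\<lambda>\<xi>. ennreal (tilt d ?v \<xi>)))"
      using F by (auto intro!: arg_cong2[where f=measure])
    also have "\<dots> = (\<integral>\<xi>. tilt d ?v \<xi> * indicator ?F \<xi> \<partial>noise d)"
      using F by (subst integral_density) (auto simp: less_imp_le tilt_pos)
    finally show ?thesis .
  qed
  also have "\<dots> = (\<integral>\<xi>. tilt d ?v \<xi> * indicator E (\<lambda>j\<in>{1..d}. \<theta>' j + \<sigma> * \<xi> j) \<partial>noise d)"
    by (intro Bochner_Integration.integral_cong) (auto simp: indicator_def)
  finally show ?thesis .
qed

subsection \<open>Odd functions of the noise\<close>

lemma integrable_std_normal_bounded_by_square:
  fixes h :: "real \<Rightarrow> real"
  assumes [measurable]: "h \<in> borel_measurable borel" and "\<And>x. \<bar>h x\<bar> \<le> 1 + x\<^sup>2"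
  shows "integrable std_normal h"
proof (rule Bochner_Integration.integrable_bound)
  have "integrable lborel (\<lambda>x. std_normal_density x * (1 + x\<^sup>2))"
    using integrable_std_normal_moment[of 0] integrable_std_normal_moment[of 2]
    by (simp add: distrib_left)
  then show "integrable std_normal (\<lambda>x. 1 + x\<^sup>2)"
    by (subst integrable_density) auto
qed (use assms(2) in \<open>auto intro!: AE_I2 order.trans[OF assms(2)]\<close>)

lemma integral_std_normal_odd:
  fixes h :: "real \<Rightarrow> real"
  assumes [measurable]: "h \<in> borel_measurable borel" and odd: "\<And>x. h (- x) = - h x"
  shows "(\<integral>x. h x \<partial>std_normal) = 0"
proof -
  have "(\<integral>x. std_normal_density x * h x \<partial>lborel) = (\<integral>x. std_normal_density (0 + (-1) * x) * h (0 + (-1) * x) \<partial>lborel)"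
    by (subst lborel_integral_real_affine[where c="-1" and t=0]) auto
  also have "\<dots> = - (\<integral>x. std_normal_density x * h x \<partial>lborel)"
    by (simp add: odd std_normal_density_def)
  finally show ?thesis
    by (subst integral_density) auto
qed

text \<open>On |x| > 2u one half of the Gaussian exponent is spent on exp(-x^2/4) <= exp(-u^2); the
  other half is sqrt 2 times the density of N(0, 2), whose second moment is 2. With u =
  \<open>lam\<close> / |\<eta> j| this produces the exponential weights of \<nu>^2, which is why the
  threshold carries the factor 2.\<close>

lemma truncated_second_moment:
  assumes "u \<ge> 0"
  shows "(\<integral>x. (if \<bar>x\<bar> > 2 * u then x else 0)\<^sup>2 \<partial>std_normal) \<le> 3 * exp (- u\<^sup>2)"
proof -
  have 1: "has_bochner_integral lborel (\<lambda>x. normal_density 0 (sqrt 2) x * x\<^sup>2) 2"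
    using normal_moment_even[of "sqrt 2" 0 1] by (simp add: power2_eq_square)
  have 2: "std_normal_density x * (if \<bar>x\<bar> > 2 * u then x else 0)\<^sup>2
     \<le> sqrt 2 * exp (- u\<^sup>2) * (normal_density 0 (sqrt 2) x * x\<^sup>2)" for x
  proof (cases "\<bar>x\<bar> > 2 * u")
    case True
    then have "(2 * u)\<^sup>2 \<le> x\<^sup>2" using assms by (metis abs_le_square_iff abs_of_nonneg less_imp_le mult_nonneg_nonneg zero_le_numeral)
    then have "exp (- x\<^sup>2 / 2) \<le> exp (- u\<^sup>2) * exp (- x\<^sup>2 / 4)"
      by (simp add: exp_add[symmetric])
    then have "1 / sqrt (2 * pi) * exp (- x\<^sup>2 / 2) * x\<^sup>2
        \<le> 1 / sqrt (2 * pi) * (exp (- u\<^sup>2) * exp (- x\<^sup>2 / 4)) * x\<^sup>2"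
      by (intro mult_left_mono mult_right_mono) auto
    moreover have "sqrt 2 * normal_density 0 (sqrt 2) x = 1 / sqrt (2 * pi) * exp (- x\<^sup>2 / 4)"
      by (simp add: normal_density_def real_sqrt_mult field_simps)
    then have "sqrt 2 * exp (- u\<^sup>2) * (normal_density 0 (sqrt 2) x * x\<^sup>2) =
        1 / sqrt (2 * pi) * exp (- x\<^sup>2 / 4) * exp (- u\<^sup>2) * x\<^sup>2"
      by (metis (no_types, opaque_lifting) mult.commute mult.left_commute)
    ultimately show ?thesis using True by (simp add: std_normal_density_def mult_ac)
  qed (use assms in simp)
  have "(\<integral>x. (if \<bar>x\<bar> > 2 * u then x else 0)\<^sup>2 \<partial>std_normal) =
      (\<integral>x. std_normal_density x * (if \<bar>x\<bar> > 2 * u then x else 0)\<^sup>2 \<partial>lborel)"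
    by (subst integral_density) auto
  also have "\<dots> \<le> (\<integral>x. sqrt 2 * exp (- u\<^sup>2) * (normal_density 0 (sqrt 2) x * x\<^sup>2) \<partial>lborel)"
    using 1 by (intro integral_mono' 2) (auto simp: has_bochner_integral_iff)
  also have "\<dots> = exp (- u\<^sup>2) * (sqrt 2 * 2)"
    using 1 by (simp add: has_bochner_integral_iff)
  also have "sqrt 2 * 2 \<le> (3::real)"
    using real_le_lsqrt[of "3 / 2" 2] by (simp add: power2_eq_square)
  finally show ?thesis by (simp add: mult.commute)
qed

text \<open>Covers both shapes of residual noise: the identity on the support and the
  hard-thresholded identity off it. Oddness centres every term; domination by |x| provides second
  moments.\<close>

locale odd_functions =
  fixes g :: "nat \<Rightarrow> real \<Rightarrow> real"
  assumes g_measurable [measurable]: "\<And>j. g j \<in> borel_measurable borel"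
    and g_odd: "\<And>j x. g j (- x) = - g j x"
    and g_bound: "\<And>j x. \<bar>g j x\<bar> \<le> \<bar>x\<bar>"
begin

lemma square_le: "(g j x)\<^sup>2 \<le> x\<^sup>2"
  using g_bound by (simp add: abs_le_square_iff)

lemma noise_covariance:
  assumes i: "i \<in> {1..d}" and j: "j \<in> {1..d}"
  shows "integrable (noise d) (\<lambda>\<xi>. g i (\<xi> i) * g j (\<xi> j))"
    and "(\<integral>\<xi>. g i (\<xi> i) * g j (\<xi> j) \<partial>noise d) = (if i = j then \<integral>x. (g i x)\<^sup>2 \<partial>std_normal else 0)"
proof -
  interpret N: product_sigma_finite "\<lambda>_::nat. std_normal" by (rule product_sigma_finite_std_normal)
  interpret prob_space std_normal by (rule prob_space_std_normal)
  \<comment> \<open>The factor belonging to coordinate k, so that the product over all coordinates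
    is \<open>g i (\<xi> i) * g j (\<xi> j)\<close>. For i = j both factors fall on one coordinate
    and give the square.\<close>
  define f where "f k x = (if k = i then g i x else 1) * (if k = j then g j x else 1)" for k x
  have x_le: "\<bar>x\<bar> \<le> 1 + x\<^sup>2" for x :: real
    using sum_power2_ge_zero[of "\<bar>x\<bar> - 1" 0] by (simp add: power2_eq_square algebra_simps)
  have int: "integrable std_normal (f k)" for k
  proof (rule integrable_std_normal_bounded_by_square)
    show "\<bar>f k x\<bar> \<le> 1 + x\<^sup>2" for x
      using order.trans[OF g_bound x_le, of i x] order.trans[OF g_bound x_le, of j x] square_le[of i x]
      by (auto simp: f_def abs_mult power2_eq_square[symmetric])
  qed (unfold f_def, measurable)
  have prod: "(\<Prod>k=1..d. f k (\<xi> k)) = g i (\<xi> i) * g j (\<xi> j)" for \<xi>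
    using i j by (simp add: f_def prod.distrib)
  show "integrable (noise d) (\<lambda>\<xi>. g i (\<xi> i) * g j (\<xi> j))"
    using N.product_integrable_prod[of "{1..d}" f] int by (simp add: prod noise_def del: One_nat_def)
  have "(\<integral>\<xi>. g i (\<xi> i) * g j (\<xi> j) \<partial>noise d) = (\<Prod>k=1..d. \<integral>x. f k x \<partial>std_normal)"
    using N.product_integral_prod[of "{1..d}" f] int by (simp add: prod noise_def del: One_nat_def)
  also have "\<dots> = (if i = j then \<integral>x. (g i x)\<^sup>2 \<partial>std_normal else 0)"
  proof (cases "i = j")
    case True
    have "(\<integral>x. f k x \<partial>std_normal) = (if k = i then \<integral>x. (g i x)\<^sup>2 \<partial>std_normal else 1)" for k
      using True prob_space by (auto simp: f_def power2_eq_square)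
    then show ?thesis using True i by simp
  next
    case False
    then have "(\<integral>x. f i x \<partial>std_normal) = 0"
      by (simp add: f_def integral_std_normal_odd g_odd)
    then show ?thesis using False i by (auto intro!: prod_zero)
  qed
  finally show "(\<integral>\<xi>. g i (\<xi> i) * g j (\<xi> j) \<partial>noise d) = (if i = j then \<integral>x. (g i x)\<^sup>2 \<partial>std_normal else 0)" .
qed

text \<open>The off-diagonal covariances vanish by independence and oddness.\<close>

lemma noise_second_moment:
  shows "integrable (noise d) (\<lambda>\<xi>. (\<Sum>j=1..d. a j * g j (\<xi> j))\<^sup>2)"
    and "(\<integral>\<xi>. (\<Sum>j=1..d. a j * g j (\<xi> j))\<^sup>2 \<partial>noise d) = (\<Sum>j=1..d. (a j)\<^sup>2 * (\<integral>x. (g j x)\<^sup>2 \<partial>std_normal))"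
proof -
  have eq: "(\<Sum>j=1..d. a j * g j (\<xi> j))\<^sup>2 =
      (\<Sum>i=1..d. \<Sum>j=1..d. a i * a j * (g i (\<xi> i) * g j (\<xi> j)))" for \<xi>
    by (simp add: power2_eq_square sum_product mult_ac)
  show "integrable (noise d) (\<lambda>\<xi>. (\<Sum>j=1..d. a j * g j (\<xi> j))\<^sup>2)"
    unfolding eq by (intro Bochner_Integration.integrable_sum integrable_mult_right noise_covariance)
  have "(\<integral>\<xi>. (\<Sum>j=1..d. a j * g j (\<xi> j))\<^sup>2 \<partial>noise d) =
      (\<Sum>i=1..d. \<Sum>j=1..d. a i * a j * (\<integral>\<xi>. g i (\<xi> i) * g j (\<xi> j) \<partial>noise d))"
    unfolding eq
    by (subst Bochner_Integration.integral_sum, (intro Bochner_Integration.integrable_sum integrable_mult_right noise_covariance; assumption))+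
       (intro sum.cong refl, subst Bochner_Integration.integral_sum, auto intro!: integrable_mult_right noise_covariance)
  also have "\<dots> = (\<Sum>i=1..d. \<Sum>j=1..d. if i = j then (a i)\<^sup>2 * (\<integral>x. (g i x)\<^sup>2 \<partial>std_normal) else 0)"
    by (intro sum.cong refl) (simp add: noise_covariance(2) power2_eq_square del: One_nat_def)
  finally show "(\<integral>\<xi>. (\<Sum>j=1..d. a j * g j (\<xi> j))\<^sup>2 \<partial>noise d) = (\<Sum>j=1..d. (a j)\<^sup>2 * (\<integral>x. (g j x)\<^sup>2 \<partial>std_normal))"
    by simp
qed

lemma noise_tail_bound:
  assumes "c > 0"
  shows "measure (noise d) {\<xi> \<in> space (noise d). c \<le> \<bar>\<Sum>j=1..d. a j * g j (\<xi> j)\<bar>}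
    \<le> (\<Sum>j=1..d. (a j)\<^sup>2 * (\<integral>x. (g j x)\<^sup>2 \<partial>std_normal)) / c\<^sup>2"
proof -
  interpret prob_space "noise d" by (rule prob_space_noise)
  have "(\<lambda>\<xi>. \<Sum>j=1..d. a j * g j (\<xi> j)) \<in> borel_measurable (noise d)"
    unfolding noise_def by measurable
  from second_moment_method[OF this noise_second_moment(1) assms]
  show ?thesis by (simp add: noise_second_moment(2) del: One_nat_def)
qed

end

subsection \<open>Upper bound\<close>

locale sparse_model =
  fixes d s :: nat and \<eta> :: "nat \<Rightarrow> real" and \<sigma> :: real
  assumes adm: "admissible d s \<eta> \<sigma>"
begin

lemma s_ge_2: "2 \<le> s" and s_le_d: "s \<le> d" and \<sigma>_pos: "\<sigma> > 0"
  using adm by (auto simp: admissible_def)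

lemma one_mem: "1 \<in> {1..d}"
  using s_ge_2 s_le_d by simp

lemma \<eta>_nonzero: "j \<in> {1..d} \<Longrightarrow> \<eta> j \<noteq> 0"
  using adm unfolding admissible_def by (metis abs_zero atLeastAtMost_iff le_refl less_le_not_le order.trans s_ge_2)

abbreviation lam :: real where "lam \<equiv> lambda_o d s \<eta>"
abbreviation \<nu> :: real where "\<nu> \<equiv> nu d s \<eta>"
abbreviation rate :: real where "rate \<equiv> lam * real s + \<nu>"

lemma lam_nonneg: "lam \<ge> 0"
  by (simp add: lambda_o_def)

lemma nu_square: "\<nu>\<^sup>2 = (\<Sum>j=1..d. (\<eta> j)\<^sup>2 * exp (- lam\<^sup>2 / (\<eta> j)\<^sup>2))"
  unfolding nu_def by (intro real_sqrt_pow2 sum_nonneg) auto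

lemma nu_pos: "\<nu> > 0"
  unfolding nu_def using one_mem \<eta>_nonzero
  by (intro real_sqrt_gt_zero sum_pos2[of _ 1] mult_nonneg_nonneg) auto

lemma rate_pos: "rate > 0"
  using nu_pos lam_nonneg by (simp add: add_nonneg_pos)

lemma r_min_eq: "r_min d s \<eta> \<sigma> = \<sigma> * rate"
  using rate_pos by (simp add: r_min_def Phi_o_def)

text \<open>A parameter with prescribed value of L carried by one coordinate, so that all but one of
  the s allowed coordinates remain free for spikes.\<close>

definition base :: "real \<Rightarrow> nat \<Rightarrow> real" where
  "base t = (\<lambda>j\<in>{1..d}. if j = 1 then t / \<eta> 1 else 0)"

lemma base_Theta: "base t \<in> Theta d s" and L_base: "L d \<eta> (base t) = t"
proof -
  have "{j \<in> {1..d}. base t j \<noteq> 0} \<subseteq> {1}" by (auto simp: base_def)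
  from card_mono[OF _ this] have "card {j \<in> {1..d}. base t j \<noteq> 0} \<le> 1" by simp
  then show "base t \<in> Theta d s" using s_ge_2 by (auto simp: Theta_def vecs_def base_def)
  have "L d \<eta> (base t) = (\<Sum>j=1..d. if j = 1 then \<eta> 1 * (t / \<eta> 1) else 0)"
    unfolding L_def base_def by (intro sum.cong) auto
  then show "L d \<eta> (base t) = t" using one_mem \<eta>_nonzero[OF one_mem] by simp
qed

lemma base_null: "base t0 \<in> Theta_null d s \<eta> t0"
  by (simp add: Theta_null_def base_Theta L_base)

text \<open>Excludes a real supremum over the empty set, whose value would be arbitrary. The shift
  by |\<rho>| works for either sign of \<rho>.\<close>

lemma Theta_alt_nonempty: "Theta_alt d s \<eta> t0 \<rho> \<noteq> {}"
proof -
  have "base (t0 + \<bar>\<rho>\<bar>) \<in> Theta_alt d s \<eta> t0 \<rho>"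
    by (simp add: Theta_alt_def base_Theta L_base)
  then show ?thesis by blast
qed

section \<open>The thresholding estimator and the test built on it\<close>

definition L_hat :: "(nat \<Rightarrow> real) \<Rightarrow> real" where
  "L_hat y = (\<Sum>j=1..d. \<eta> j * (if \<bar>y j\<bar> > 2 * \<sigma> * lam / \<bar>\<eta> j\<bar> then y j else 0))"

lemma measurable_L_hat [measurable]: "L_hat \<in> borel_measurable (obs_space d)"
  unfolding L_hat_def obs_space_def by measurable

text \<open>Either (\<eta> j)^2 is at most \<open>lam\<close>^2, or the exponential weight of j is
  at least 1/e >= 1/3, and then (\<eta> j)^2 is at most three times its summand in \<nu>^2. Summing
  over S gives at most s \<open>lam\<close>^2 + 3 \<nu>^2.\<close>

lemma support_energy:
  assumes S: "S \<subseteq> {1..d}" "card S \<le> s"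
  shows "(\<Sum>j\<in>S. (\<eta> j)\<^sup>2) \<le> 3 * rate\<^sup>2"
proof -
  have fin: "finite S" using S(1) by (rule finite_subset) simp
  have "(\<eta> j)\<^sup>2 \<le> lam\<^sup>2 + 3 * ((\<eta> j)\<^sup>2 * exp (- lam\<^sup>2 / (\<eta> j)\<^sup>2))" if "j \<in> S" for j
  proof (cases "(\<eta> j)\<^sup>2 \<le> lam\<^sup>2")
    case False
    have "exp (- 1) \<le> exp (- lam\<^sup>2 / (\<eta> j)\<^sup>2)"
      using False by (simp add: divide_le_eq)
    moreover have "1 / 3 \<le> exp (- 1 :: real)"
      using e_less_272 by (simp add: exp_minus field_simps)
    ultimately have "1 \<le> 3 * exp (- lam\<^sup>2 / (\<eta> j)\<^sup>2)"
      by linarith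
    then have "(\<eta> j)\<^sup>2 * 1 \<le> (\<eta> j)\<^sup>2 * (3 * exp (- lam\<^sup>2 / (\<eta> j)\<^sup>2))"
      by (rule mult_left_mono) simp
    then show ?thesis using zero_le_power2[of lam] by linarith
  qed (intro add_increasing2; simp)
  then have "(\<Sum>j\<in>S. (\<eta> j)\<^sup>2) \<le> (\<Sum>j\<in>S. lam\<^sup>2 + 3 * ((\<eta> j)\<^sup>2 * exp (- lam\<^sup>2 / (\<eta> j)\<^sup>2)))"
    by (rule sum_mono)
  also have "\<dots> = card S * lam\<^sup>2 + 3 * (\<Sum>j\<in>S. (\<eta> j)\<^sup>2 * exp (- lam\<^sup>2 / (\<eta> j)\<^sup>2))"
    by (simp add: sum.distrib sum_distrib_left)
  also have "\<dots> \<le> (real s)\<^sup>2 * lam\<^sup>2 + 3 * \<nu>\<^sup>2"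
  proof (intro add_mono mult_right_mono mult_left_mono)
    have "real (card S) \<le> real s * 1" using S by simp
    also have "\<dots> \<le> real s * real s" using s_ge_2 by (intro mult_left_mono) auto
    finally show "real (card S) \<le> (real s)\<^sup>2" by (simp add: power2_eq_square)
    show "(\<Sum>j\<in>S. (\<eta> j)\<^sup>2 * exp (- lam\<^sup>2 / (\<eta> j)\<^sup>2)) \<le> \<nu>\<^sup>2"
      unfolding nu_square using S by (intro sum_mono2) auto
  qed auto
  also have "\<dots> \<le> 3 * rate\<^sup>2"
  proof -
    have "3 * rate\<^sup>2 = 3 * ((real s)\<^sup>2 * lam\<^sup>2) + 6 * (lam * real s * \<nu>) + 3 * \<nu>\<^sup>2"
      by (simp add: power2_eq_square algebra_simps)
    moreover have "0 \<le> lam * real s * \<nu>" using lam_nonneg nu_pos by simp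
    moreover have "0 \<le> (real s)\<^sup>2 * lam\<^sup>2" by simp
    ultimately show ?thesis by linarith
  qed
  finally show ?thesis .
qed

text \<open>The error is \<sigma> Z plus the thresholding bias, at most 2 \<sigma>
  \<open>lam\<close> for each of at most s coordinates. The second moment of Z is at most 6
  \<open>rate\<close>^2, namely 3 \<open>rate\<close>^2 from the support and 3 \<nu>^2 from the
  truncated noise off it. Chebyshev's inequality at level A \<open>rate\<close> / 4 gives 96 /
  A^2.\<close>

lemma L_hat_deviation:
  assumes \<theta>: "\<theta> \<in> Theta d s" and A: "A \<ge> 8"
  shows "measure (obs_law d \<sigma> \<theta>)
      {y \<in> space (obs_law d \<sigma> \<theta>). A * (\<sigma> * rate) / 2 \<le> \<bar>L_hat y - L d \<eta> \<theta>\<bar>} \<le> 96 / A\<^sup>2"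
proof -
  define S where "S = {j \<in> {1..d}. \<theta> j \<noteq> 0}"
  have S: "S \<subseteq> {1..d}" "card S \<le> s" using \<theta> by (auto simp: S_def Theta_def)
  have fin: "finite S" using S(1) by (rule finite_subset) simp
  \<comment> \<open>Off the support the observation is \<sigma> times the noise, so thresholding
    acts on the noise itself. On the support the full noise is kept and the effect of thresholding
    is counted as bias.\<close>
  define g where "g j x = (if j \<in> S \<or> \<bar>x\<bar> > 2 * (lam / \<bar>\<eta> j\<bar>) then x else 0)" for j and x :: real
  interpret odd_functions g
  proof
    show "g j \<in> borel_measurable borel" for j unfolding g_def[abs_def] by measurable
  qed (auto simp: g_def)
  interpret noise: prob_space "noise d" by (rule prob_space_noise)
  define Z where "Z \<xi> = (\<Sum>j=1..d. \<eta> j * g j (\<xi> j))" for \<xi>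
  have Z_meas: "Z \<in> borel_measurable (noise d)"
    unfolding Z_def noise_def by measurable
  let ?E = "{y \<in> space (obs_space d). A * (\<sigma> * rate) / 2 \<le> \<bar>L_hat y - L d \<eta> \<theta>\<bar>}"
  have sp: "space (obs_law d \<sigma> \<theta>) = space (obs_space d)"
    by (simp add: obs_law_def)
  have dev: "\<bar>L_hat (\<lambda>j\<in>{1..d}. \<theta> j + \<sigma> * \<xi> j) - L d \<eta> \<theta>\<bar> \<le> \<sigma> * \<bar>Z \<xi>\<bar> + s * (2 * \<sigma> * lam)" for \<xi>
  proof -
    let ?y = "\<lambda>j. \<theta> j + \<sigma> * \<xi> j"
    define e where "e j = \<eta> j * (if \<bar>?y j\<bar> > 2 * \<sigma> * lam / \<bar>\<eta> j\<bar> then ?y j else 0) - \<eta> j * \<theta> j - \<sigma> * (\<eta> j * g j (\<xi> j))" for j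
    have e0: "e j = 0" if "j \<in> {1..d} - S" for j
    proof -
      have "\<theta> j = 0" "j \<notin> S" using that by (auto simp: S_def)
      moreover have "2 * \<sigma> * lam / \<bar>\<eta> j\<bar> < \<bar>\<sigma> * \<xi> j\<bar> \<longleftrightarrow> 2 * (lam / \<bar>\<eta> j\<bar>) < \<bar>\<xi> j\<bar>"
        using \<sigma>_pos mult_less_cancel_left_pos[of \<sigma> "2 * (lam / \<bar>\<eta> j\<bar>)" "\<bar>\<xi> j\<bar>"] by (simp add: abs_mult mult_ac)
      ultimately show ?thesis by (simp add: e_def g_def)
    qed
    have e1: "\<bar>e j\<bar> \<le> 2 * \<sigma> * lam" if "j \<in> S" for j
    proof -
      have "\<eta> j \<noteq> 0" using that S \<eta>_nonzero by auto
      then have pos: "\<bar>\<eta> j\<bar> > 0" by simp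
      \<comment> \<open>On the support a remainder survives only where \<open>?y j\<close> is at or
        below its threshold, and the threshold is scaled so that \<eta> j times it is 2 \<sigma>
        \<open>lam\<close> in absolute value.\<close>
      have "e j = (if \<bar>?y j\<bar> > 2 * \<sigma> * lam / \<bar>\<eta> j\<bar> then 0 else - (\<eta> j * ?y j))"
        using that by (simp add: e_def g_def algebra_simps)
      moreover have "\<bar>\<eta> j * ?y j\<bar> \<le> 2 * \<sigma> * lam" if "\<bar>?y j\<bar> \<le> 2 * \<sigma> * lam / \<bar>\<eta> j\<bar>"
        using that pos by (simp add: pos_le_divide_eq abs_mult mult.commute)
      ultimately show ?thesis using \<sigma>_pos lam_nonneg by auto
    qed
    have "L_hat (\<lambda>j\<in>{1..d}. ?y j) - L d \<eta> \<theta> = \<sigma> * Z \<xi> + (\<Sum>j=1..d. e j)"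
      unfolding L_hat_def L_def Z_def sum_distrib_left sum_subtractf[symmetric] sum.distrib[symmetric]
      by (intro sum.cong refl) (simp add: e_def)
    also have "(\<Sum>j=1..d. e j) = (\<Sum>j\<in>S. e j)"
      using S e0 by (intro sum.mono_neutral_right) auto
    also have "\<bar>\<sigma> * Z \<xi> + (\<Sum>j\<in>S. e j)\<bar> \<le> \<sigma> * \<bar>Z \<xi>\<bar> + (\<Sum>j\<in>S. \<bar>e j\<bar>)"
    proof -
      have "\<bar>\<sigma> * Z \<xi>\<bar> = \<sigma> * \<bar>Z \<xi>\<bar>" using \<sigma>_pos by (simp add: abs_mult)
      then show ?thesis using sum_abs[of e S] by linarith
    qed
    also have "(\<Sum>j\<in>S. \<bar>e j\<bar>) \<le> card S * (2 * \<sigma> * lam)"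
      using sum_bounded_above[of S "\<lambda>j. \<bar>e j\<bar>" "2 * \<sigma> * lam"] e1 by simp
    also have "\<dots> \<le> s * (2 * \<sigma> * lam)"
      using S \<sigma>_pos lam_nonneg by (intro mult_right_mono) auto
    finally show ?thesis by (simp del: One_nat_def restrict_apply)
  qed
  have E: "?E \<in> sets (obs_space d)" by measurable
  have "measure (obs_law d \<sigma> \<theta>) ?E = measure (noise d) {\<xi> \<in> space (noise d). (\<lambda>j\<in>{1..d}. \<theta> j + \<sigma> * \<xi> j) \<in> ?E}"
    by (rule measure_obs_law[OF E])
  also have "\<dots> \<le> measure (noise d) {\<xi> \<in> space (noise d). A / 4 * rate \<le> \<bar>Z \<xi>\<bar>}"
  proof (rule noise.finite_measure_mono)
    show "{\<xi> \<in> space (noise d). (\<lambda>j\<in>{1..d}. \<theta> j + \<sigma> * \<xi> j) \<in> ?E} \<subseteq> {\<xi> \<in> space (noise d). A / 4 * rate \<le> \<bar>Z \<xi>\<bar>}"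
    proof (intro subsetI CollectI conjI; elim CollectE conjE)
      fix \<xi> assume "A * (\<sigma> * rate) / 2 \<le> \<bar>L_hat (\<lambda>j\<in>{1..d}. \<theta> j + \<sigma> * \<xi> j) - L d \<eta> \<theta>\<bar>"
      with dev[of \<xi>] have "A * (\<sigma> * rate) / 2 \<le> \<sigma> * \<bar>Z \<xi>\<bar> + s * (2 * \<sigma> * lam)" by linarith
      then have "\<sigma> * (A / 2 * rate) \<le> \<sigma> * (\<bar>Z \<xi>\<bar> + 2 * (lam * s))" by (simp add: algebra_simps)
      then have "A / 2 * rate \<le> \<bar>Z \<xi>\<bar> + 2 * (lam * s)" using \<sigma>_pos by simp
      moreover have "lam * s \<le> rate" using nu_pos by simp
      \<comment> \<open>A >= 8 absorbs the bias: 2 \<open>lam\<close> s <= 2 \<open>rate\<close> <=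
        (A/4) \<open>rate\<close>, which leaves A/4 of the original A/2.\<close>
      moreover have "8 * rate \<le> A * rate" using A rate_pos by (intro mult_right_mono) auto
      ultimately show "A / 4 * rate \<le> \<bar>Z \<xi>\<bar>" by simp
    qed
    show "{\<xi> \<in> space (noise d). A / 4 * rate \<le> \<bar>Z \<xi>\<bar>} \<in> sets (noise d)"
      using Z_meas by measurable
  qed
  also have "\<dots> \<le> (\<Sum>j=1..d. (\<eta> j)\<^sup>2 * (\<integral>x. (g j x)\<^sup>2 \<partial>std_normal)) / (A / 4 * rate)\<^sup>2"
    unfolding Z_def by (rule noise_tail_bound) (use A rate_pos in simp)
  also have "\<dots> \<le> 6 * rate\<^sup>2 / (A / 4 * rate)\<^sup>2"
  proof (rule divide_right_mono)
    have var1: "(\<integral>x. x\<^sup>2 \<partial>std_normal) = 1"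
      using integral_std_normal_moment_even[of 1] by (subst integral_density) auto
    have "(\<Sum>j=1..d. (\<eta> j)\<^sup>2 * (\<integral>x. (g j x)\<^sup>2 \<partial>std_normal))
        \<le> (\<Sum>j=1..d. (if j \<in> S then (\<eta> j)\<^sup>2 else 0) + 3 * ((\<eta> j)\<^sup>2 * exp (- lam\<^sup>2 / (\<eta> j)\<^sup>2)))"
    proof (rule sum_mono)
      fix j assume "j \<in> {1..d}"
      show "(\<eta> j)\<^sup>2 * (\<integral>x. (g j x)\<^sup>2 \<partial>std_normal) \<le> (if j \<in> S then (\<eta> j)\<^sup>2 else 0) + 3 * ((\<eta> j)\<^sup>2 * exp (- lam\<^sup>2 / (\<eta> j)\<^sup>2))"
      proof (cases "j \<in> S")
        case True
        then show ?thesis by (simp add: g_def var1)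
      next
        case False
        then have "(\<integral>x. (g j x)\<^sup>2 \<partial>std_normal) \<le> 3 * exp (- (lam / \<bar>\<eta> j\<bar>)\<^sup>2)"
          using truncated_second_moment[of "lam / \<bar>\<eta> j\<bar>"] lam_nonneg by (simp add: g_def)
        then have "(\<eta> j)\<^sup>2 * (\<integral>x. (g j x)\<^sup>2 \<partial>std_normal) \<le> (\<eta> j)\<^sup>2 * (3 * exp (- (lam / \<bar>\<eta> j\<bar>)\<^sup>2))"
          by (rule mult_left_mono) simp
        then show ?thesis using False by (simp add: power_divide)
      qed
    qed
    also have "\<dots> = (\<Sum>j\<in>S. (\<eta> j)\<^sup>2) + 3 * \<nu>\<^sup>2"
      using S by (simp add: sum.distrib sum_distrib_left nu_square sum.inter_restrict[symmetric] Int_absorb1 del: One_nat_def)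
    also have "\<dots> \<le> 3 * rate\<^sup>2 + 3 * rate\<^sup>2"
      using support_energy[OF S] lam_nonneg nu_pos by (intro add_mono mult_left_mono power_mono) auto
    finally show "(\<Sum>j=1..d. (\<eta> j)\<^sup>2 * (\<integral>x. (g j x)\<^sup>2 \<partial>std_normal)) \<le> 6 * rate\<^sup>2" by simp
  qed simp
  also have "\<dots> = 96 / A\<^sup>2"
    using A rate_pos by (simp add: power_mult_distrib power_divide)
  finally show ?thesis by (simp add: sp)
qed

text \<open>The test rejects when the estimator is farther than half the separation from t0. By the
  triangle inequality an error of either kind forces a deviation of at least that half, and each
  costs 96 / A^2.\<close>

lemma upper_bound:
  assumes A: "A \<ge> 8"
  shows "minimax_risk d s \<eta> \<sigma> t0 (A * r_min d s \<eta> \<sigma>) \<le> 192 / A\<^sup>2"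
proof -
  let ?r = "A * (\<sigma> * rate)"
  define \<Delta> where "\<Delta> y = (if \<bar>L_hat y - t0\<bar> > ?r / 2 then 1 else 0 :: nat)" for y
  have sp: "space (obs_law d \<sigma> \<theta>) = space (obs_space d)" for \<theta>
    by (simp add: obs_law_def)
  have st: "sets (obs_law d \<sigma> \<theta>) = sets (obs_space d)" for \<theta>
    by (simp add: obs_law_def)
  have ev: "{y \<in> space (obs_law d \<sigma> \<theta>). ?r / 2 \<le> \<bar>L_hat y - L d \<eta> \<theta>\<bar>} \<in> sets (obs_law d \<sigma> \<theta>)" for \<theta>
    unfolding sp st by measurable
  have mono: "measure (obs_law d \<sigma> \<theta>) {y \<in> space (obs_law d \<sigma> \<theta>). P y} \<le> 96 / A\<^sup>2"
    if "\<theta> \<in> Theta d s" "\<And>y. P y \<Longrightarrow> ?r / 2 \<le> \<bar>L_hat y - L d \<eta> \<theta>\<bar>" for \<theta> P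
  proof -
    interpret prob_space "obs_law d \<sigma> \<theta>" by (rule prob_space_obs_law)
    have "measure (obs_law d \<sigma> \<theta>) {y \<in> space (obs_law d \<sigma> \<theta>). P y}
       \<le> measure (obs_law d \<sigma> \<theta>) {y \<in> space (obs_law d \<sigma> \<theta>). ?r / 2 \<le> \<bar>L_hat y - L d \<eta> \<theta>\<bar>}"
      using that(2) by (intro finite_measure_mono ev) auto
    with L_hat_deviation[OF that(1) A] show ?thesis by linarith
  qed
  have "\<Delta> \<in> tests d"
    unfolding tests_def \<Delta>_def by measurable
  then have "minimax_risk d s \<eta> \<sigma> t0 ?r \<le>
      (SUP \<theta>\<in>Theta_null d s \<eta> t0. measure (obs_law d \<sigma> \<theta>) {y \<in> space (obs_law d \<sigma> \<theta>). \<Delta> y = 1}) +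
      (SUP \<theta>\<in>Theta_alt d s \<eta> t0 ?r. measure (obs_law d \<sigma> \<theta>) {y \<in> space (obs_law d \<sigma> \<theta>). \<Delta> y = 0})"
    unfolding minimax_risk_def
  \<comment> \<open>A real infimum is below its members only if the set is bounded below. The bound
    0 holds because both suprema run over nonempty families of probabilities.\<close>
  proof (intro cINF_lower bdd_belowI2[where m=0] add_nonneg_nonneg)
    fix \<Delta> :: "(nat \<Rightarrow> real) \<Rightarrow> nat"
    have bdd: "bdd_above ((\<lambda>\<theta>. measure (obs_law d \<sigma> \<theta>) (E \<theta>)) ` T)" for E T
      by (intro bdd_aboveI2[where M=1] prob_space.prob_le_1 prob_space_obs_law)
    show "0 \<le> (SUP \<theta>\<in>Theta_null d s \<eta> t0. measure (obs_law d \<sigma> \<theta>) {y \<in> space (obs_law d \<sigma> \<theta>). \<Delta> y = 1})"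
      by (rule cSUP_upper2[OF bdd base_null]) simp
    from Theta_alt_nonempty obtain \<theta> where "\<theta> \<in> Theta_alt d s \<eta> t0 ?r" by blast
    then show "0 \<le> (SUP \<theta>\<in>Theta_alt d s \<eta> t0 ?r. measure (obs_law d \<sigma> \<theta>) {y \<in> space (obs_law d \<sigma> \<theta>). \<Delta> y = 0})"
      by (rule cSUP_upper2[OF bdd]) simp
  qed
  also have "\<dots> \<le> 96 / A\<^sup>2 + 96 / A\<^sup>2"
  proof (intro add_mono cSUP_least mono)
    show "Theta_null d s \<eta> t0 \<noteq> {}" using base_null by blast
    show "Theta_alt d s \<eta> t0 ?r \<noteq> {}" by (rule Theta_alt_nonempty)
  next
    fix \<theta> y assume "\<theta> \<in> Theta_null d s \<eta> t0" "\<Delta> y = 1"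
    then show "?r / 2 \<le> \<bar>L_hat y - L d \<eta> \<theta>\<bar>" by (auto simp: \<Delta>_def Theta_null_def split: if_splits)
  next
    fix \<theta> y assume "\<theta> \<in> Theta_alt d s \<eta> t0 ?r" "\<Delta> y = 0"
    then have "?r \<le> \<bar>L d \<eta> \<theta> - t0\<bar>" "\<bar>L_hat y - t0\<bar> \<le> ?r / 2"
      by (auto simp: \<Delta>_def Theta_alt_def split: if_splits)
    then show "?r / 2 \<le> \<bar>L_hat y - L d \<eta> \<theta>\<bar>" by arith
  qed (auto simp: Theta_null_def Theta_alt_def)
  finally show ?thesis by (simp add: r_min_eq)
qed

end

subsection \<open>Testing against a mixture of spikes\<close>

lemma tilt_cong: "(\<And>j. j \<in> {1..d} \<Longrightarrow> u j = v j) \<Longrightarrow> tilt d u \<xi> = tilt d v \<xi>"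
  unfolding tilt_def by (intro prod.cong) auto

text \<open>Expand the square: a product of tilts is a multiple of a tilt, and every tilt has
  integral 1. The result is the chi-square divergence of a Gaussian mixture from the pure
  noise.\<close>

lemma chi_square_mixture:
  assumes I: "finite I"
  shows "integrable (noise d) (\<lambda>\<xi>. ((\<Sum>i\<in>I. w i * tilt d (v i) \<xi>) - 1)\<^sup>2)" (is ?int)
    and "(\<Sum>i\<in>I. w i) = 1 \<Longrightarrow> (\<integral>\<xi>. ((\<Sum>i\<in>I. w i * tilt d (v i) \<xi>) - 1)\<^sup>2 \<partial>noise d) =
      (\<Sum>i\<in>I. \<Sum>k\<in>I. w i * w k * exp (\<Sum>j=1..d. v i j * v k j)) - 1"
proof -
  interpret prob_space "noise d" by (rule prob_space_noise)
  let ?T = "\<lambda>\<xi>. \<Sum>i\<in>I. \<Sum>k\<in>I. w i * w k * exp (\<Sum>j=1..d. v i j * v k j) * tilt d (\<lambda>j. v i j + v k j) \<xi>"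
  let ?U = "\<lambda>\<xi>. \<Sum>i\<in>I. w i * tilt d (v i) \<xi>"
  have eq: "(?U \<xi> - 1)\<^sup>2 = ?T \<xi> - 2 * ?U \<xi> + 1" for \<xi>
  proof -
    have "(?U \<xi>)\<^sup>2 = (\<Sum>i\<in>I. \<Sum>k\<in>I. w i * w k * (tilt d (v i) \<xi> * tilt d (v k) \<xi>))"
      by (simp add: power2_eq_square sum_product mult_ac)
    also have "\<dots> = ?T \<xi>" by (simp add: tilt_mult mult_ac)
    finally show ?thesis by (simp add: power2_diff)
  qed
  have T: "integrable (noise d) ?T" and U: "integrable (noise d) ?U"
    by (intro Bochner_Integration.integrable_sum integrable_mult_right integrable_tilt)+
  show ?int unfolding eq using T U by (intro Bochner_Integration.integrable_add Bochner_Integration.integrable_diff) auto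
  assume w: "(\<Sum>i\<in>I. w i) = 1"
  have "(\<integral>\<xi>. ?T \<xi> \<partial>noise d) = (\<Sum>i\<in>I. \<Sum>k\<in>I. w i * w k * exp (\<Sum>j=1..d. v i j * v k j))"
    by (simp add: Bochner_Integration.integral_sum Bochner_Integration.integrable_sum integrable_tilt integral_tilt)
  moreover have "(\<integral>\<xi>. ?U \<xi> \<partial>noise d) = 1"
    by (simp add: Bochner_Integration.integral_sum integrable_tilt integral_tilt w)
  ultimately show "(\<integral>\<xi>. (?U \<xi> - 1)\<^sup>2 \<partial>noise d) = (\<Sum>i\<in>I. \<Sum>k\<in>I. w i * w k * exp (\<Sum>j=1..d. v i j * v k j)) - 1"
    unfolding eq using T U by (simp add: prob_space)
qed

section \<open>Le Cam's method for a prior on spikes\<close>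

context sparse_model
begin

text \<open>The sign of \<open>\<eta> j\<close> makes j in B contribute \<sigma> |\<eta> j| \<gamma>
  j to L; \<gamma> is measured in units of the noise level.\<close>

definition spike :: "real \<Rightarrow> (nat \<Rightarrow> real) \<Rightarrow> nat set \<Rightarrow> nat \<Rightarrow> real" where
  "spike t0 \<gamma> B = (\<lambda>j\<in>{1..d}. base t0 j + \<sigma> * (if j \<in> B then sgn (\<eta> j) * \<gamma> j else 0))"

text \<open>The strict inequality on the size of B reserves one coordinate for the null
  parameter.\<close>

lemma spike_alt:
  assumes B: "B \<subseteq> {1..d}" "card B < s" "\<rho> \<le> \<sigma> * (\<Sum>j\<in>B. \<bar>\<eta> j\<bar> * \<gamma> j)"
  shows "spike t0 \<gamma> B \<in> Theta_alt d s \<eta> t0 \<rho>"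
proof -
  have fin: "finite B" using B(1) by (rule finite_subset) simp
  have "card {j \<in> {1..d}. spike t0 \<gamma> B j \<noteq> 0} \<le> card (insert 1 B)"
    using fin by (intro card_mono) (auto simp: spike_def base_def split: if_splits)
  also have "\<dots> \<le> s"
    using B(2) fin by (simp add: card_insert_if)
  finally have "spike t0 \<gamma> B \<in> Theta d s"
    by (simp add: Theta_def vecs_def spike_def)
  moreover have "L d \<eta> (spike t0 \<gamma> B) = t0 + \<sigma> * (\<Sum>j\<in>B. \<bar>\<eta> j\<bar> * \<gamma> j)"
  proof -
    have "L d \<eta> (spike t0 \<gamma> B) = L d \<eta> (base t0) + (\<Sum>j=1..d. if j \<in> B then \<sigma> * (\<bar>\<eta> j\<bar> * \<gamma> j) else 0)"
      unfolding L_def sum.distrib[symmetric] spike_def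
      by (intro sum.cong refl) (auto simp: distrib_left abs_sgn)
    also have "(\<Sum>j=1..d. if j \<in> B then \<sigma> * (\<bar>\<eta> j\<bar> * \<gamma> j) else 0) = \<sigma> * (\<Sum>j\<in>B. \<bar>\<eta> j\<bar> * \<gamma> j)"
      using B(1) by (simp add: sum.inter_restrict[symmetric] Int_absorb1 sum_distrib_left del: One_nat_def)
    finally show ?thesis by (simp add: L_base)
  qed
  ultimately show ?thesis using B(3) by (simp add: Theta_alt_def)
qed

text \<open>The worst alternative dominates the prior average up to \<delta>, the bound on the mass
  of supports that are too large or give too little separation. The average acceptance probability
  falls short of its null value by at most \<kappa> as soon as the chi-square divergence of the
  mixture is at most \<kappa>^2.\<close>

lemma lower_bound_prior:
  fixes B :: "'i \<Rightarrow> nat set"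
  assumes I: "finite I" and B: "\<And>i. i \<in> I \<Longrightarrow> B i \<subseteq> {1..d}"
    and w: "\<And>i. i \<in> I \<Longrightarrow> w i \<ge> 0" "(\<Sum>i\<in>I. w i) = 1"
    and \<kappa>: "\<kappa> > 0"
    and chi: "(\<Sum>i\<in>I. \<Sum>k\<in>I. w i * w k * exp (\<Sum>j\<in>B i \<inter> B k. (\<gamma> j)\<^sup>2)) \<le> 1 + \<kappa>\<^sup>2"
    and bad: "(\<Sum>i\<in>{i \<in> I. \<not> (card (B i) < s \<and> \<rho> \<le> \<sigma> * (\<Sum>j\<in>B i. \<bar>\<eta> j\<bar> * \<gamma> j))}. w i) \<le> \<delta>"
  shows "minimax_risk d s \<eta> \<sigma> t0 \<rho> \<ge> 1 - \<kappa> - \<delta>"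
  unfolding minimax_risk_def
proof (rule cINF_greatest)
  have "(\<lambda>_. 0) \<in> tests d" by (simp add: tests_def)
  then show "tests d \<noteq> {}" by blast
next
  fix \<Delta> assume \<Delta>: "\<Delta> \<in> tests d"
  have [measurable]: "\<Delta> \<in> measurable (obs_space d) (count_space UNIV)"
    using measurable_compose[OF \<Delta>[unfolded tests_def], of "\<lambda>x. x" "count_space UNIV"] by simp
  let ?P = "\<lambda>\<theta>. measure (obs_law d \<sigma> \<theta>)"
  let ?S1 = "SUP \<theta>\<in>Theta_null d s \<eta> t0. ?P \<theta> {y \<in> space (obs_law d \<sigma> \<theta>). \<Delta> y = 1}"
  let ?S2 = "SUP \<theta>\<in>Theta_alt d s \<eta> t0 \<rho>. ?P \<theta> {y \<in> space (obs_law d \<sigma> \<theta>). \<Delta> y = 0}"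
  define E where "E k = {y \<in> space (obs_space d). \<Delta> y = k}" for k
  have E_meas: "E k \<in> sets (obs_space d)" for k unfolding E_def by measurable
  have sp: "space (obs_law d \<sigma> \<theta>) = space (obs_space d)" for \<theta>
    by (simp add: obs_law_def)
  have bdd: "bdd_above ((\<lambda>\<theta>. ?P \<theta> (F \<theta>)) ` T)" for F T
    by (intro bdd_aboveI2[where M=1] prob_space.prob_le_1 prob_space_obs_law)
  have S1: "?P (base t0) (E 1) \<le> ?S1"
    by (rule cSUP_upper2[OF bdd base_null]) (simp add: E_def sp)
  have E1: "?P (base t0) (E 1) = 1 - ?P (base t0) (E 0)"
  proof -
    interpret prob_space "obs_law d \<sigma> (base t0)" by (rule prob_space_obs_law)
    have "\<Delta> y = 1 \<longleftrightarrow> \<Delta> y \<noteq> 0" if "y \<in> space (obs_space d)" for y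
      using measurable_space[OF \<Delta>[unfolded tests_def] that] by auto
    then have "E 1 = space (obs_law d \<sigma> (base t0)) - E 0"
      by (auto simp: E_def sp)
    moreover have "E 0 \<in> events" using E_meas[of 0] by (simp add: obs_law_def)
    ultimately show ?thesis by (simp add: prob_compl)
  qed
  define good where "good i \<longleftrightarrow> card (B i) < s \<and> \<rho> \<le> \<sigma> * (\<Sum>j\<in>B i. \<bar>\<eta> j\<bar> * \<gamma> j)" for i
  let ?\<theta> = "\<lambda>i. spike t0 \<gamma> (B i)"
  have S2_nonneg: "0 \<le> ?S2"
  proof -
    obtain \<theta> where "\<theta> \<in> Theta_alt d s \<eta> t0 \<rho>" using Theta_alt_nonempty by blast
    then show ?thesis by (rule cSUP_upper2[OF bdd]) simp
  qed
  have S2: "?P (?\<theta> i) (E 0) \<le> ?S2" if "i \<in> I" "good i" for i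
    using that spike_alt[OF B[OF that(1)]] by (intro cSUP_upper2[OF bdd]) (auto simp: good_def E_def sp)
  have "(\<Sum>i\<in>I. w i * ?P (?\<theta> i) (E 0)) \<le> (\<Sum>i\<in>I. w i * ?S2 + (if good i then 0 else w i))"
  proof (rule sum_mono)
    fix i assume i: "i \<in> I"
    show "w i * ?P (?\<theta> i) (E 0) \<le> w i * ?S2 + (if good i then 0 else w i)"
    proof (cases "good i")
      case True
      then show ?thesis using S2[OF i] w(1)[OF i] by (simp add: mult_left_mono)
    next
      case False
      have "?P (?\<theta> i) (E 0) \<le> 1"
        by (intro prob_space.prob_le_1 prob_space_obs_law)
      then have "w i * ?P (?\<theta> i) (E 0) \<le> w i * 1"
        using w(1)[OF i] by (rule mult_left_mono)
      then show ?thesis using False mult_nonneg_nonneg[OF w(1)[OF i] S2_nonneg] by simp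
    qed
  qed
  also have "\<dots> = ?S2 + (\<Sum>i\<in>{i \<in> I. \<not> good i}. w i)"
    using I w(2) by (simp add: sum.distrib sum_distrib_right[symmetric] sum.inter_filter if_not_P cong: if_cong)
      (intro sum.cong; simp)
  also have "\<dots> \<le> ?S2 + \<delta>" using bad by (simp add: good_def)
  finally have mix: "(\<Sum>i\<in>I. w i * ?P (?\<theta> i) (E 0)) \<le> ?S2 + \<delta>" .

  define v where "v i j = (if j \<in> B i then sgn (\<eta> j) * \<gamma> j else 0)" for i j
  define h where "h \<xi> = (indicator (E 0) (\<lambda>j\<in>{1..d}. base t0 j + \<sigma> * \<xi> j) :: real)" for \<xi>
  \<comment> \<open>Centred likelihood ratio of the mixture against \<open>base t0\<close>; the
    integral of its square is the chi-square divergence.\<close>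
  define G where "G \<xi> = (\<Sum>i\<in>I. w i * tilt d (v i) \<xi>) - 1" for \<xi>
  have h_meas [measurable]: "h \<in> borel_measurable (noise d)"
    unfolding h_def using measurable_observation E_meas by measurable
  have h_01: "0 \<le> h \<xi>" "h \<xi> \<le> 1" for \<xi> by (auto simp: h_def indicator_def)
  have int_h: "integrable (noise d) (\<lambda>\<xi>. tilt d u \<xi> * h \<xi>)" for u
    using h_01 by (intro Bochner_Integration.integrable_bound[OF integrable_tilt[of d u]])
      (auto simp: abs_mult intro!: AE_I2 mult_left_le)
  have P_spike: "?P (?\<theta> i) (E 0) = (\<integral>\<xi>. tilt d (v i) \<xi> * h \<xi> \<partial>noise d)" for i
  proof -
    have "tilt d (\<lambda>j. (?\<theta> i j - base t0 j) / \<sigma>) \<xi> = tilt d (v i) \<xi>" for \<xi>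
      using \<sigma>_pos by (intro tilt_cong) (simp add: spike_def v_def)
    then show ?thesis
      unfolding measure_obs_law_shift[OF E_meas \<sigma>_pos, where \<theta>'="base t0"] h_def by simp
  qed
  have tilt_0: "tilt d (\<lambda>_. 0) \<xi> = 1" for \<xi> by (simp add: tilt_def)
  have P_base: "?P (base t0) (E 0) = (\<integral>\<xi>. h \<xi> \<partial>noise d)"
    unfolding measure_obs_law_shift[OF E_meas \<sigma>_pos, where \<theta>'="base t0"] h_def by (simp add: tilt_0)
  have int_G: "integrable (noise d) (\<lambda>\<xi>. (G \<xi>)\<^sup>2)"
    unfolding G_def by (rule chi_square_mixture(1)[OF I])
  have G_le: "(\<integral>\<xi>. (G \<xi>)\<^sup>2 \<partial>noise d) \<le> \<kappa>\<^sup>2"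
  proof -
    have "(\<Sum>j=1..d. v i j * v k j) = (\<Sum>j\<in>B i \<inter> B k. (\<gamma> j)\<^sup>2)" if "i \<in> I" "k \<in> I" for i k
    proof -
      \<comment> \<open>Since no \<eta> j vanishes, the signs square to 1, and only common
        coordinates of the two supports contribute.\<close>
      have "(\<Sum>j=1..d. v i j * v k j) = (\<Sum>j=1..d. if j \<in> B i \<inter> B k then (\<gamma> j)\<^sup>2 else 0)"
        using \<eta>_nonzero by (intro sum.cong refl) (auto simp: v_def power2_eq_square sgn_if)
      also have "\<dots> = (\<Sum>j\<in>B i \<inter> B k. (\<gamma> j)\<^sup>2)"
        using B[OF that(1)] by (simp add: sum.inter_restrict[symmetric] Int_absorb1 le_infI1 del: One_nat_def Int_iff)
      finally show ?thesis .
    qed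
    then have "(\<Sum>i\<in>I. \<Sum>k\<in>I. w i * w k * exp (\<Sum>j=1..d. v i j * v k j)) \<le> 1 + \<kappa>\<^sup>2"
      using chi by (simp del: One_nat_def)
    then show ?thesis unfolding G_def chi_square_mixture(2)[OF I w(2)] by simp
  qed
  interpret noise: prob_space "noise d" by (rule prob_space_noise)
  have diff: "(\<Sum>i\<in>I. w i * ?P (?\<theta> i) (E 0)) - ?P (base t0) (E 0) = (\<integral>\<xi>. G \<xi> * h \<xi> \<partial>noise d)"
  proof -
    have "(\<lambda>\<xi>. G \<xi> * h \<xi>) = (\<lambda>\<xi>. (\<Sum>i\<in>I. w i * (tilt d (v i) \<xi> * h \<xi>)) - h \<xi>)"
      by (simp add: G_def left_diff_distrib sum_distrib_right mult.assoc)
    moreover have "integrable (noise d) h"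
      using int_h[of "\<lambda>_. 0"] by (simp add: tilt_0)
    ultimately show ?thesis
      by (simp add: P_spike P_base int_h Bochner_Integration.integral_sum Bochner_Integration.integrable_sum)
  qed
  \<comment> \<open>AM-GM in place of the Cauchy--Schwarz bound \<open>E |G| \<le> sqrt (E G\<^sup>2)\<close>\<close>
  have pt: "- (((G \<xi>)\<^sup>2 / \<kappa> + \<kappa>) / 2) \<le> G \<xi> * h \<xi>" for \<xi>
  proof -
    have "0 \<le> (\<bar>G \<xi>\<bar> - \<kappa>)\<^sup>2 / \<kappa>" using \<kappa> by simp
    also have "(\<bar>G \<xi>\<bar> - \<kappa>)\<^sup>2 / \<kappa> = (G \<xi>)\<^sup>2 / \<kappa> + \<kappa> - 2 * \<bar>G \<xi>\<bar>"
      using \<kappa> by (simp add: power2_eq_square field_simps)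
    finally have "\<bar>G \<xi>\<bar> \<le> ((G \<xi>)\<^sup>2 / \<kappa> + \<kappa>) / 2" by simp
    moreover have "\<bar>G \<xi> * h \<xi>\<bar> \<le> \<bar>G \<xi>\<bar>"
      using h_01 by (simp add: abs_mult mult_left_le)
    ultimately show ?thesis by linarith
  qed
  have "- \<kappa> \<le> - (((\<integral>\<xi>. (G \<xi>)\<^sup>2 \<partial>noise d) / \<kappa> + \<kappa>) / 2)"
    using G_le \<kappa> by (simp add: divide_le_eq power2_eq_square)
  also have "\<dots> = (\<integral>\<xi>. - (((G \<xi>)\<^sup>2 / \<kappa> + \<kappa>) / 2) \<partial>noise d)"
    using int_G by (simp add: noise.prob_space)
  also have "\<dots> \<le> (\<integral>\<xi>. G \<xi> * h \<xi> \<partial>noise d)"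
  proof (rule integral_mono)
    have "(\<lambda>\<xi>. G \<xi> * h \<xi>) = (\<lambda>\<xi>. (\<Sum>i\<in>I. w i * (tilt d (v i) \<xi> * h \<xi>)) - tilt d (\<lambda>_. 0) \<xi> * h \<xi>)"
      by (simp add: G_def left_diff_distrib sum_distrib_right mult.assoc tilt_0)
    then show "integrable (noise d) (\<lambda>\<xi>. G \<xi> * h \<xi>)"
      by (simp only:) (intro Bochner_Integration.integrable_diff Bochner_Integration.integrable_sum integrable_mult_right int_h)
  qed (use int_G pt in auto)
  \<comment> \<open>The first error is at least one minus the null probability of
    \<open>E 0\<close>, the second at least the mixture probability of \<open>E 0\<close> minus
    \<delta>; the two probabilities of \<open>E 0\<close> differ by the integral of G h.\<close>
  finally show "1 - \<kappa> - \<delta> \<le> ?S1 + ?S2"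
    using diff mix S1 E1 by linarith
qed

end

subsection \<open>The equation defining beta\<close>

context sparse_model
begin

text \<open>Left-hand side of the equation that defines \<open>beta\<close>.\<close>

definition crit :: "real \<Rightarrow> real" where
  "crit b = (\<Sum>j=1..d. \<bar>\<eta> j\<bar> * exp (- b / (\<eta> j)\<^sup>2)) / sqrt (\<Sum>j=1..d. (\<eta> j)\<^sup>2 * exp (- b / (\<eta> j)\<^sup>2))"

lemma crit_parts_pos:
  "(\<Sum>j=1..d. \<bar>\<eta> j\<bar> * exp (- b / (\<eta> j)\<^sup>2)) > 0" "(\<Sum>j=1..d. (\<eta> j)\<^sup>2 * exp (- b / (\<eta> j)\<^sup>2)) > 0"
  using one_mem \<eta>_nonzero by (auto intro!: sum_pos2[of _ 1] mult_nonneg_nonneg)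

lemma crit_nonneg: "crit b \<ge> 0"
  unfolding crit_def using crit_parts_pos[of b] by (intro divide_nonneg_nonneg) auto

lemma crit_square:
  "(crit b)\<^sup>2 = (\<Sum>j=1..d. \<bar>\<eta> j\<bar> * exp (- b / (\<eta> j)\<^sup>2))\<^sup>2 / (\<Sum>j=1..d. (\<eta> j)\<^sup>2 * exp (- b / (\<eta> j)\<^sup>2))"
  unfolding crit_def power_divide using crit_parts_pos[of b] by (subst real_sqrt_pow2) auto

text \<open>Write the squares as S1^2/S2 at b and T1^2/T2 at b'. The weights shrink strictly, so T1
  < S1, and they shrink least where |\<eta>| is large, so T1/T2 <= S1/S2; multiply the two.\<close>

lemma crit_strict_antimono:
  assumes "b < b'"
  shows "crit b' < crit b"
proof -
  define c where "c j = \<bar>\<eta> j\<bar> * exp (- b / (\<eta> j)\<^sup>2)" for j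
  define t where "t j = exp (- (b' - b) / (\<eta> j)\<^sup>2)" for j
  have c': "\<bar>\<eta> j\<bar> * exp (- b' / (\<eta> j)\<^sup>2) = c j * t j" for j
    by (simp add: c_def t_def exp_add[symmetric] diff_divide_distrib)
  have sq: "(\<eta> j)\<^sup>2 * exp (- x / (\<eta> j)\<^sup>2) = \<bar>\<eta> j\<bar> * (\<bar>\<eta> j\<bar> * exp (- x / (\<eta> j)\<^sup>2))" for x j
    by (simp add: power2_eq_square)
  let ?I = "{1..d}"
  define S1 S2 T1 T2 where "S1 = (\<Sum>j\<in>?I. c j)" and "S2 = (\<Sum>j\<in>?I. \<bar>\<eta> j\<bar> * c j)"
    and "T1 = (\<Sum>j\<in>?I. c j * t j)" and "T2 = (\<Sum>j\<in>?I. \<bar>\<eta> j\<bar> * (c j * t j))"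
  have crit: "(crit b)\<^sup>2 = S1\<^sup>2 / S2" "(crit b')\<^sup>2 = T1\<^sup>2 / T2"
    unfolding crit_square sq c' S1_def S2_def T1_def T2_def c_def[symmetric] by simp_all
  have pos: "S1 > 0" "S2 > 0" "T1 > 0" "T2 > 0"
    using crit_parts_pos[of b] crit_parts_pos[of b']
    unfolding sq c' S1_def S2_def T1_def T2_def c_def[symmetric] by simp_all
  have c_pos: "c j > 0" if "j \<in> ?I" for j
    using \<eta>_nonzero[OF that] by (simp add: c_def)
  have t_mono: "t i \<le> t j" if "\<bar>\<eta> i\<bar> \<le> \<bar>\<eta> j\<bar>" "i \<in> ?I" for i j
  proof -
    have "0 < (\<eta> i)\<^sup>2" "(\<eta> i)\<^sup>2 \<le> (\<eta> j)\<^sup>2"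
      using that \<eta>_nonzero[OF that(2)] by (simp_all add: abs_le_square_iff)
    then have "(b' - b) / (\<eta> j)\<^sup>2 \<le> (b' - b) / (\<eta> i)\<^sup>2"
      using assms by (intro divide_left_mono mult_pos_pos) auto
    then show ?thesis by (simp add: t_def diff_divide_distrib)
  qed
  \<comment> \<open>Chebyshev's sum inequality: passing from \<open>b\<close> to \<open>b'\<close> multiplies the weights by \<open>t\<close>, which increases with \<open>|\<eta>|\<close>.\<close>
  have cheb: "T1 * S2 \<le> S1 * T2"
  proof -
    \<comment> \<open>Symmetrising in i and j pairs the terms into products of two differences of
      the same sign.\<close>
    define D where "D i j = c i * c j * \<bar>\<eta> j\<bar> * (t j - t i)" for i j
    have "S1 * T2 - T1 * S2 = (\<Sum>i\<in>?I. \<Sum>j\<in>?I. D i j)"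
      unfolding S1_def S2_def T1_def T2_def D_def sum_product sum_subtractf[symmetric]
      by (intro sum.cong refl) (simp add: algebra_simps)
    moreover have "(\<Sum>i\<in>?I. \<Sum>j\<in>?I. D i j) = (\<Sum>i\<in>?I. \<Sum>j\<in>?I. D j i)"
      by (rule sum.swap)
    moreover have "0 \<le> (\<Sum>i\<in>?I. \<Sum>j\<in>?I. D i j + D j i)"
    proof (intro sum_nonneg)
      fix i j assume ij: "i \<in> ?I" "j \<in> ?I"
      have "D i j + D j i = c i * c j * ((\<bar>\<eta> j\<bar> - \<bar>\<eta> i\<bar>) * (t j - t i))"
        by (simp add: D_def algebra_simps)
      moreover have "0 \<le> (\<bar>\<eta> j\<bar> - \<bar>\<eta> i\<bar>) * (t j - t i)"
        using t_mono[of i j] t_mono[of j i] ij by (cases "\<bar>\<eta> i\<bar> \<le> \<bar>\<eta> j\<bar>") (auto intro: mult_nonneg_nonneg mult_nonpos_nonpos)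
      ultimately show "0 \<le> D i j + D j i" using c_pos[OF ij(1)] c_pos[OF ij(2)] by simp
    qed
    ultimately show ?thesis by (simp add: sum.distrib)
  qed
  have "T1 < S1"
    unfolding T1_def S1_def
  proof (rule sum_strict_mono)
    fix j assume j: "j \<in> ?I"
    have "0 < (b' - b) / (\<eta> j)\<^sup>2" using assms \<eta>_nonzero[OF j] by simp
    then have "t j < 1" unfolding t_def by (simp add: diff_divide_distrib)
    then show "c j * t j < c j" using c_pos[OF j] by simp
  qed (use one_mem in auto)
  have "T1\<^sup>2 * S2 \<le> T1 * (S1 * T2)"
    using mult_left_mono[OF cheb, of T1] pos by (simp add: power2_eq_square mult_ac)
  also have "\<dots> < S1 * (S1 * T2)"
    using \<open>T1 < S1\<close> pos by (intro mult_strict_right_mono) auto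
  finally have "T1\<^sup>2 / T2 < S1\<^sup>2 / S2"
    using pos by (simp add: divide_simps power2_eq_square mult_ac)
  then have "(crit b')\<^sup>2 < (crit b)\<^sup>2" by (simp add: crit)
  then show ?thesis using crit_nonneg by (rule power2_less_imp_less)
qed

lemma continuous_crit: "continuous_on A crit"
  unfolding crit_def using \<eta>_nonzero less_imp_neq[OF crit_parts_pos(2), symmetric]
  by (intro continuous_intros) (simp_all del: One_nat_def)

text \<open>Right end of the interval for the intermediate value theorem. Splitting each exponential
  into two equal factors, Cauchy-Schwarz bounds the square of \<open>crit\<close> by the sum of the
  exponentials; at this b each is at most 1/d because |\<eta> 1| is the largest.\<close>

lemma crit_le_1: "crit ((\<eta> 1)\<^sup>2 * ln d) \<le> 1"
proof -
  let ?b = "(\<eta> 1)\<^sup>2 * ln d"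
  let ?S = "\<Sum>j=1..d. (\<eta> j)\<^sup>2 * exp (- ?b / (\<eta> j)\<^sup>2)"
  have d: "real d \<ge> 1" using s_ge_2 s_le_d by simp
  have split: "exp (- ?b / (\<eta> j)\<^sup>2) = exp (- ?b / (2 * (\<eta> j)\<^sup>2)) * exp (- ?b / (2 * (\<eta> j)\<^sup>2))" for j
    by (simp add: exp_add[symmetric])
  have "(\<Sum>j=1..d. \<bar>\<eta> j\<bar> * exp (- ?b / (\<eta> j)\<^sup>2))\<^sup>2 =
     (\<Sum>j=1..d. (\<bar>\<eta> j\<bar> * exp (- ?b / (2 * (\<eta> j)\<^sup>2))) * exp (- ?b / (2 * (\<eta> j)\<^sup>2)))\<^sup>2"
    by (simp only: split mult.assoc)
  also have "\<dots> \<le> (\<Sum>j=1..d. (\<bar>\<eta> j\<bar> * exp (- ?b / (2 * (\<eta> j)\<^sup>2)))\<^sup>2) * (\<Sum>j=1..d. (exp (- ?b / (2 * (\<eta> j)\<^sup>2)))\<^sup>2)"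
    by (rule Cauchy_Schwarz_ineq_sum)
  also have "\<dots> = ?S * (\<Sum>j=1..d. exp (- ?b / (\<eta> j)\<^sup>2))"
    by (simp only: power_mult_distrib power2_abs power2_eq_square[of "exp _"] split[symmetric])
  also have "\<dots> \<le> ?S * 1"
  proof (rule mult_left_mono)
    have "exp (- ?b / (\<eta> j)\<^sup>2) \<le> 1 / d" if j: "j \<in> {1..d}" for j
    proof -
      have "\<bar>\<eta> j\<bar> \<le> \<bar>\<eta> 1\<bar>" using adm j one_mem by (auto simp: admissible_def)
      then have "1 \<le> (\<eta> 1)\<^sup>2 / (\<eta> j)\<^sup>2"
        using \<eta>_nonzero[OF j] by (simp add: abs_le_square_iff)
      then have "1 * ln d \<le> (\<eta> 1)\<^sup>2 / (\<eta> j)\<^sup>2 * ln d" using d by (intro mult_right_mono) auto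
      then have "exp (- ?b / (\<eta> j)\<^sup>2) \<le> exp (- ln d)" by simp
      then show ?thesis using d by (simp add: exp_minus inverse_eq_divide)
    qed
    from sum_bounded_above[of "{1..d}", OF this] show "(\<Sum>j=1..d. exp (- ?b / (\<eta> j)\<^sup>2)) \<le> 1"
      using d by simp
  qed (intro sum_nonneg, simp)
  finally have "(crit ?b)\<^sup>2 \<le> 1\<^sup>2"
    unfolding crit_square using crit_parts_pos(2)[of ?b] by (simp add: divide_le_eq)
  then show ?thesis by (rule power2_le_imp_le) simp
qed

text \<open>Left end of the interval. The square of a sum of nonnegative terms is at least the sum
  of their squares, and at this b every exponential weight is at least (s/2)^2; s >= 2 makes the
  logarithm nonnegative.\<close>

lemma crit_ge_half_s: "crit (- ((\<eta> 1)\<^sup>2 * ln ((s / 2)\<^sup>2))) \<ge> s / 2"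
proof -
  define l where "l = ln ((real s / 2)\<^sup>2)"
  define w where "w j = exp (- (- ((\<eta> 1)\<^sup>2 * l)) / (\<eta> j)\<^sup>2)" for j
  have s: "(real s / 2)\<^sup>2 \<ge> 1" using s_ge_2 by simp
  have w: "(s / 2)\<^sup>2 \<le> w j" if j: "j \<in> {1..d}" for j
  proof -
    have "\<bar>\<eta> j\<bar> \<le> \<bar>\<eta> 1\<bar>" using adm j one_mem by (auto simp: admissible_def)
    then have "1 \<le> (\<eta> 1)\<^sup>2 / (\<eta> j)\<^sup>2"
      using \<eta>_nonzero[OF j] by (simp add: abs_le_square_iff)
    then have "1 * l \<le> (\<eta> 1)\<^sup>2 / (\<eta> j)\<^sup>2 * l"
      using s by (intro mult_right_mono) (auto simp: l_def)
    then have "exp l \<le> w j" by (simp add: w_def)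
    moreover have "exp l = (s / 2)\<^sup>2" unfolding l_def using s by (intro exp_ln) linarith
    ultimately show ?thesis by simp
  qed
  have "(s / 2)\<^sup>2 * (\<Sum>j=1..d. (\<eta> j)\<^sup>2 * w j) \<le> (\<Sum>j=1..d. (\<bar>\<eta> j\<bar> * w j)\<^sup>2)"
    unfolding sum_distrib_left
  proof (rule sum_mono)
    fix j assume "j \<in> {1..d}"
    from mult_right_mono[OF w[OF this], of "(\<eta> j)\<^sup>2 * w j"]
    have "(s / 2)\<^sup>2 * ((\<eta> j)\<^sup>2 * w j) \<le> w j * ((\<eta> j)\<^sup>2 * w j)" by (simp add: w_def)
    also have "\<dots> = (\<bar>\<eta> j\<bar> * w j)\<^sup>2"
      unfolding power_mult_distrib power2_abs by (simp add: power2_eq_square mult_ac)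
    finally show "(s / 2)\<^sup>2 * ((\<eta> j)\<^sup>2 * w j) \<le> (\<bar>\<eta> j\<bar> * w j)\<^sup>2" .
  qed
  also have "\<dots> \<le> (\<Sum>j=1..d. \<bar>\<eta> j\<bar> * w j)\<^sup>2"
  proof -
    have "L2_set (\<lambda>j. \<bar>\<eta> j\<bar> * w j) {1..d} \<le> (\<Sum>j=1..d. \<bar>\<eta> j\<bar> * w j)"
      by (rule L2_set_le_sum) (simp add: w_def)
    from power_mono[OF this, of 2] show ?thesis
      by (simp add: L2_set_def sum_nonneg del: One_nat_def)
  qed
  finally have "(s / 2)\<^sup>2 \<le> (crit (- ((\<eta> 1)\<^sup>2 * l)))\<^sup>2"
    unfolding crit_square w_def[symmetric]
    using crit_parts_pos(2)[of "- ((\<eta> 1)\<^sup>2 * l)", folded w_def] by (subst pos_le_divide_eq) auto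
  then show ?thesis unfolding l_def[symmetric] using crit_nonneg by (rule power2_le_imp_le)
qed

text \<open>Existence by continuity between the two ends, uniqueness by strict monotonicity; hence
  the definite description denotes the root.\<close>

lemma crit_beta: "crit (beta d s \<eta>) = s / 2"
proof -
  have "(s / 2)\<^sup>2 \<ge> (1::real)" "real d \<ge> 1" "s / 2 \<ge> (1::real)" using s_ge_2 s_le_d by auto
  then have "- ((\<eta> 1)\<^sup>2 * ln ((s / 2)\<^sup>2)) \<le> 0" "0 \<le> (\<eta> 1)\<^sup>2 * ln d"
    "crit ((\<eta> 1)\<^sup>2 * ln d) \<le> s / 2"
    using crit_le_1 by auto
  then have "\<exists>b. - ((\<eta> 1)\<^sup>2 * ln ((s / 2)\<^sup>2)) \<le> b \<and> b \<le> (\<eta> 1)\<^sup>2 * ln d \<and> crit b = s / 2"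
    using crit_ge_half_s continuous_crit by (intro IVT2') linarith+
  then obtain b where b: "crit b = s / 2" by blast
  have "\<exists>!b. crit b = s / 2"
  proof (rule ex1I)
    show "crit b = s / 2" by (rule b)
    show "b' = b" if "crit b' = s / 2" for b'
      using that b crit_strict_antimono[of b b'] crit_strict_antimono[of b' b] by (cases b b' rule: linorder_cases) auto
  qed
  then have "crit (THE b. crit b = s / 2) = s / 2" by (rule theI')
  then show ?thesis unfolding beta_def crit_def[symmetric] .
qed

section \<open>Clipping \<open>beta\<close> at zero, and the inclusion profile
  \<open>p\<close>\<close>

lemma lam_square: "lam\<^sup>2 = max (beta d s \<eta>) 0"
  by (simp add: lambda_o_def)

text \<open>Clipping moves the argument to the right, where \<open>crit\<close> is smaller, or
  leaves it at the root.\<close>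

lemma crit_lam_le: "crit (lam\<^sup>2) \<le> s / 2"
  using crit_strict_antimono[of "beta d s \<eta>" "lam\<^sup>2"] crit_beta
  by (cases "beta d s \<eta> < lam\<^sup>2") (auto simp: lam_square max_def split: if_splits)

lemma crit_lam: "lam > 0 \<Longrightarrow> crit (lam\<^sup>2) = s / 2"
  using crit_beta unfolding lam_square by (auto simp: lambda_o_def max_def split: if_splits)

definition p :: "nat \<Rightarrow> real" where
  "p j = \<bar>\<eta> j\<bar> * exp (- lam\<^sup>2 / (\<eta> j)\<^sup>2) / \<nu>"

lemma p_nonneg: "p j \<ge> 0"
  using nu_pos by (simp add: p_def)

lemma sum_p: "(\<Sum>j=1..d. p j) = crit (lam\<^sup>2)"
  by (simp add: p_def crit_def nu_def sum_divide_distrib)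

lemma p_square: "(p j)\<^sup>2 * exp (lam\<^sup>2 / (\<eta> j)\<^sup>2) = (\<eta> j)\<^sup>2 * exp (- lam\<^sup>2 / (\<eta> j)\<^sup>2) / \<nu>\<^sup>2"
  by (simp add: p_def power_divide power_mult_distrib power2_eq_square[of "exp _"] exp_add[symmetric] mult.assoc)

lemma sum_p_square: "(\<Sum>j=1..d. (p j)\<^sup>2 * exp (lam\<^sup>2 / (\<eta> j)\<^sup>2)) = 1"
  unfolding p_square sum_divide_distrib[symmetric] nu_square[symmetric] using nu_pos by simp

lemma sum_p_abs: "(\<Sum>j=1..d. p j * \<bar>\<eta> j\<bar>) = \<nu>"
proof -
  have "(\<Sum>j=1..d. p j * \<bar>\<eta> j\<bar>) = (\<Sum>j=1..d. (\<eta> j)\<^sup>2 * exp (- lam\<^sup>2 / (\<eta> j)\<^sup>2)) / \<nu>"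
    unfolding sum_divide_distrib
  proof (intro sum.cong refl)
    fix j
    have "p j * \<bar>\<eta> j\<bar> = (\<bar>\<eta> j\<bar> * \<bar>\<eta> j\<bar>) * exp (- lam\<^sup>2 / (\<eta> j)\<^sup>2) / \<nu>"
      unfolding p_def by (simp only: divide_inverse mult_ac)
    then show "p j * \<bar>\<eta> j\<bar> = (\<eta> j)\<^sup>2 * exp (- lam\<^sup>2 / (\<eta> j)\<^sup>2) / \<nu>"
      unfolding abs_mult_self_eq power2_eq_square .
  qed
  then show ?thesis
    unfolding nu_square[symmetric] using nu_pos by (simp add: power2_eq_square[of \<nu>])
qed

lemma sum_p_square_le: "(\<Sum>j=1..d. (p j)\<^sup>2) \<le> 1"
  unfolding sum_p_square[symmetric]
  by (intro sum_mono mult_le_cancel_left1[THEN iffD2]) auto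

text \<open>Allows \<epsilon>/4 times \<open>p j\<close> to serve as an inclusion
  probability.\<close>

lemma p_le_1:
  assumes j: "j \<in> {1..d}"
  shows "p j \<le> 1"
proof -
  have "(p j)\<^sup>2 \<le> (\<Sum>j=1..d. (p j)\<^sup>2)" using j by (intro member_le_sum) auto
  then have "(p j)\<^sup>2 \<le> 1\<^sup>2" using sum_p_square_le by simp
  then show ?thesis by (rule power2_le_imp_le) simp
qed

end

subsection \<open>Random supports and lower bound\<close>

text \<open>Probability that a random subset of D, containing each j independently with probability
  q j, equals B.\<close>

definition bernoulli_weight :: "('a \<Rightarrow> real) \<Rightarrow> 'a set \<Rightarrow> 'a set \<Rightarrow> real" where
  "bernoulli_weight q D B = (\<Prod>j\<in>B. q j) * (\<Prod>j\<in>D - B. 1 - q j)"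

text \<open>Expanding the product over D chooses, for each j, inclusion or exclusion. The chi-square
  bound and both tail bounds for random supports are instances of this generating function.\<close>

lemma bernoulli_weight_prod:
  assumes D: "finite D"
  shows "(\<Sum>B\<in>Pow D. bernoulli_weight q D B * (\<Prod>j\<in>B. f j)) = (\<Prod>j\<in>D. 1 - q j + q j * f j)"
proof -
  have "(\<Prod>j\<in>D. q j * f j + (1 - q j)) = (\<Sum>B\<in>Pow D. (\<Prod>j\<in>B. q j * f j) * (\<Prod>j\<in>D - B. 1 - q j))"
    by (rule prod_add[OF D])
  then show ?thesis
    by (simp add: bernoulli_weight_def prod.distrib mult_ac add.commute)
qed

text \<open>Convexity of exp on the segment from 0 to x. It makes the chi-square cost of a spike
  scaled by a at most a^2 times the original cost.\<close>

lemma exp_scale_le: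
  fixes c x :: real
  assumes "0 \<le> c" "c \<le> 1"
  shows "exp (c * x) - 1 \<le> c * (exp x - 1)"
proof -
  have "exp ((1 - c) *\<^sub>R 0 + c *\<^sub>R x) \<le> (1 - c) * exp 0 + c * exp x"
    using assms by (intro convex_onD[OF exp_convex]) auto
  then show ?thesis by (simp add: algebra_simps)
qed

lemma exp_le_1_plus_double:
  fixes x :: real
  assumes "0 \<le> x" "x \<le> 1"
  shows "exp x \<le> 1 + 2 * x"
proof -
  have "exp x - 1 \<le> x * (exp 1 - 1)" using exp_scale_le[OF assms, of 1] by simp
  also have "\<dots> \<le> x * 2" using e_less_272 assms by (intro mult_left_mono) auto
  finally show ?thesis by simp
qed

text \<open>The chord of exp over [-1, 0] has slope 1 - 1/e >= 1/2.\<close>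

lemma exp_minus_le:
  fixes x :: real
  assumes "0 \<le> x" "x \<le> 1"
  shows "exp (- x) \<le> 1 - x / 2"
proof -
  have "exp (- x) - 1 \<le> x * (exp (- 1) - 1)" using exp_scale_le[OF assms, of "-1"] by simp
  also have "exp (- 1 :: real) \<le> 1 / 2"
    using exp_ge_add_one_self[of 1] by (simp add: exp_minus field_simps)
  then have "x * (exp (- 1) - 1) \<le> x * (- 1 / 2)" using assms by (intro mult_left_mono) auto
  finally show ?thesis by simp
qed

section \<open>Chi-square and tail bounds for random supports\<close>

locale bernoulli_support =
  fixes D :: "'a set" and q :: "'a \<Rightarrow> real"
  assumes D: "finite D" and q01: "\<And>j. j \<in> D \<Longrightarrow> 0 \<le> q j \<and> q j \<le> 1"
begin

abbreviation wt :: "'a set \<Rightarrow> real" where "wt \<equiv> bernoulli_weight q D"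

lemma wt_nonneg: "B \<subseteq> D \<Longrightarrow> wt B \<ge> 0"
  unfolding bernoulli_weight_def using q01 by (intro mult_nonneg_nonneg prod_nonneg) auto

lemma sum_wt: "(\<Sum>B\<in>Pow D. wt B) = 1"
  using bernoulli_weight_prod[OF D, of q "\<lambda>_. 1"] by simp

text \<open>Summing over B' first gives a factor 1 + q (exp(\<gamma>^2) - 1) for each j in B and 1
  elsewhere. Summing over B then gives factors 1 + q^2 (exp(\<gamma>^2) - 1), bounded by 1 + x <=
  exp x.\<close>

lemma wt_chi:
  "(\<Sum>B\<in>Pow D. \<Sum>B'\<in>Pow D. wt B * wt B' * exp (\<Sum>j\<in>B \<inter> B'. (\<gamma> j)\<^sup>2))
     \<le> exp (\<Sum>j\<in>D. (q j)\<^sup>2 * (exp ((\<gamma> j)\<^sup>2) - 1))"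
proof -
  have inner: "(\<Sum>B'\<in>Pow D. wt B * wt B' * exp (\<Sum>j\<in>B \<inter> B'. (\<gamma> j)\<^sup>2)) =
      wt B * (\<Prod>j\<in>B. 1 + q j * (exp ((\<gamma> j)\<^sup>2) - 1))" if B: "B \<in> Pow D" for B
  proof -
    let ?f = "\<lambda>j. if j \<in> B then exp ((\<gamma> j)\<^sup>2) else 1"
    have "exp (\<Sum>j\<in>B \<inter> B'. (\<gamma> j)\<^sup>2) = (\<Prod>j\<in>B'. ?f j)" if "B' \<in> Pow D" for B'
    proof -
      have fin: "finite B'" using that D by (auto intro: finite_subset)
      then have "exp (\<Sum>j\<in>B \<inter> B'. (\<gamma> j)\<^sup>2) = (\<Prod>j\<in>B' \<inter> B. exp ((\<gamma> j)\<^sup>2))"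
        by (subst exp_sum) (auto simp: Int_commute)
      then show ?thesis using fin by (simp add: prod.inter_restrict)
    qed
    then have "(\<Sum>B'\<in>Pow D. wt B * wt B' * exp (\<Sum>j\<in>B \<inter> B'. (\<gamma> j)\<^sup>2)) =
        wt B * (\<Sum>B'\<in>Pow D. wt B' * (\<Prod>j\<in>B'. ?f j))"
      by (simp add: sum_distrib_left mult.assoc)
    also have "\<dots> = wt B * (\<Prod>j\<in>D. 1 - q j + q j * ?f j)"
      by (simp only: bernoulli_weight_prod[OF D])
    also have "(\<Prod>j\<in>D. 1 - q j + q j * ?f j) = (\<Prod>j\<in>B. 1 + q j * (exp ((\<gamma> j)\<^sup>2) - 1))"
      using B D by (intro prod.mono_neutral_cong_right) (auto simp: algebra_simps)
    finally show ?thesis .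
  qed
  have "(\<Sum>B\<in>Pow D. \<Sum>B'\<in>Pow D. wt B * wt B' * exp (\<Sum>j\<in>B \<inter> B'. (\<gamma> j)\<^sup>2)) =
      (\<Prod>j\<in>D. 1 - q j + q j * (1 + q j * (exp ((\<gamma> j)\<^sup>2) - 1)))"
    by (simp only: inner bernoulli_weight_prod[OF D] cong: sum.cong)
  also have "\<dots> \<le> (\<Prod>j\<in>D. exp ((q j)\<^sup>2 * (exp ((\<gamma> j)\<^sup>2) - 1)))"
  proof (intro prod_mono conjI)
    fix j assume "j \<in> D"
    have eq: "1 - q j + q j * (1 + q j * (exp ((\<gamma> j)\<^sup>2) - 1)) = 1 + (q j)\<^sup>2 * (exp ((\<gamma> j)\<^sup>2) - 1)"
      by (simp add: power2_eq_square algebra_simps)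
    show "0 \<le> 1 - q j + q j * (1 + q j * (exp ((\<gamma> j)\<^sup>2) - 1))"
      unfolding eq by (intro add_nonneg_nonneg mult_nonneg_nonneg) auto
    show "1 - q j + q j * (1 + q j * (exp ((\<gamma> j)\<^sup>2) - 1)) \<le> exp ((q j)\<^sup>2 * (exp ((\<gamma> j)\<^sup>2) - 1))"
      unfolding eq by (rule exp_ge_add_one_self)
  qed
  also have "\<dots> = exp (\<Sum>j\<in>D. (q j)\<^sup>2 * (exp ((\<gamma> j)\<^sup>2) - 1))"
    using D by (simp add: exp_sum)
  finally show ?thesis .
qed

text \<open>Chernoff bound: Markov's inequality for K to the power \<open>card B\<close>.\<close>

lemma wt_card_tail:
  assumes K: "K \<ge> 1"
  shows "(\<Sum>B\<in>{B \<in> Pow D. s \<le> card B}. wt B) \<le> exp ((K - 1) * (\<Sum>j\<in>D. q j)) / K ^ s"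
proof -
  have "(\<Sum>B\<in>{B \<in> Pow D. s \<le> card B}. wt B) \<le> (\<Sum>B\<in>{B \<in> Pow D. s \<le> card B}. wt B * K ^ card B / K ^ s)"
  proof (rule sum_mono)
    fix B assume B: "B \<in> {B \<in> Pow D. s \<le> card B}"
    then have "K ^ s \<le> K ^ card B" using K by (intro power_increasing) auto
    then have "wt B * 1 \<le> wt B * (K ^ card B / K ^ s)"
      using K B by (intro mult_left_mono wt_nonneg) auto
    then show "wt B \<le> wt B * K ^ card B / K ^ s" by simp
  qed
  also have "\<dots> \<le> (\<Sum>B\<in>Pow D. wt B * K ^ card B / K ^ s)"
    using D K wt_nonneg by (intro sum_mono2) auto
  also have "\<dots> = (\<Prod>j\<in>D. 1 - q j + q j * K) / K ^ s"
    using bernoulli_weight_prod[OF D, of q "\<lambda>_. K"] by (simp add: sum_divide_distrib[symmetric])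
  also have "(\<Prod>j\<in>D. 1 - q j + q j * K) \<le> (\<Prod>j\<in>D. exp ((K - 1) * q j))"
  proof (intro prod_mono conjI)
    fix j assume j: "j \<in> D"
    show "0 \<le> 1 - q j + q j * K" using q01[OF j] K by simp
    show "1 - q j + q j * K \<le> exp ((K - 1) * q j)"
      using exp_ge_add_one_self[of "(K - 1) * q j"] by (simp add: algebra_simps)
  qed
  then have "(\<Prod>j\<in>D. 1 - q j + q j * K) / K ^ s \<le> (\<Prod>j\<in>D. exp ((K - 1) * q j)) / K ^ s"
    using K by (intro divide_right_mono) auto
  also have "\<dots> = exp ((K - 1) * (\<Sum>j\<in>D. q j)) / K ^ s"
    using D by (simp add: exp_sum sum_distrib_left)
  finally show ?thesis .
qed

text \<open>Markov's inequality for exp(-t times the sum of c over B). M is the mean of that sum,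
  and t c <= 1 bounds the Laplace transform by exp(-t M / 2); the level M/4 costs exp(t M /
  4).\<close>

lemma wt_lower_tail:
  fixes c :: "'a \<Rightarrow> real"
  assumes t: "t \<ge> 0" and c: "\<And>j. j \<in> D \<Longrightarrow> c j \<ge> 0 \<and> t * c j \<le> 1"
  defines "M \<equiv> \<Sum>j\<in>D. q j * c j"
  shows "(\<Sum>B\<in>{B \<in> Pow D. (\<Sum>j\<in>B. c j) < M / 4}. wt B) \<le> exp (- (t * M / 4))"
proof -
  let ?F = "\<lambda>B. exp (t * M / 4) * (wt B * (\<Prod>j\<in>B. exp (- (t * c j))))"
  have "(\<Sum>B\<in>{B \<in> Pow D. (\<Sum>j\<in>B. c j) < M / 4}. wt B) \<le> (\<Sum>B\<in>{B \<in> Pow D. (\<Sum>j\<in>B. c j) < M / 4}. ?F B)"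
  proof (rule sum_mono)
    fix B assume B: "B \<in> {B \<in> Pow D. (\<Sum>j\<in>B. c j) < M / 4}"
    then have fin: "finite B" using D by (auto intro: finite_subset)
    have "t * (\<Sum>j\<in>B. c j) \<le> t * (M / 4)" using B t by (intro mult_left_mono) auto
    then have "1 \<le> exp (t * M / 4 - t * (\<Sum>j\<in>B. c j))" by simp
    also have "\<dots> = exp (t * M / 4) * (\<Prod>j\<in>B. exp (- (t * c j)))"
      using fin by (simp add: exp_sum[symmetric] sum_negf sum_distrib_left exp_add[symmetric])
    finally have "wt B * 1 \<le> wt B * (exp (t * M / 4) * (\<Prod>j\<in>B. exp (- (t * c j))))"
      using B by (intro mult_left_mono wt_nonneg) auto
    then show "wt B \<le> ?F B" by (simp add: mult_ac)
  qed
  also have "\<dots> \<le> (\<Sum>B\<in>Pow D. ?F B)"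
    using D wt_nonneg by (intro sum_mono2) (auto intro!: mult_nonneg_nonneg prod_nonneg)
  also have "\<dots> = exp (t * M / 4) * (\<Prod>j\<in>D. 1 - q j + q j * exp (- (t * c j)))"
    unfolding sum_distrib_left[symmetric] bernoulli_weight_prod[OF D] ..
  also have "\<dots> \<le> exp (t * M / 4) * (\<Prod>j\<in>D. exp (- (t * (q j * c j) / 2)))"
  proof (intro mult_left_mono prod_mono conjI)
    fix j assume j: "j \<in> D"
    have nn: "0 \<le> q j * exp (- (t * c j))" using q01[OF j] by simp
    then show "0 \<le> 1 - q j + q j * exp (- (t * c j))" using q01[OF j] by linarith
    have "q j * exp (- (t * c j)) \<le> q j * (1 - t * c j / 2)"
      using q01[OF j] c[OF j] t by (intro mult_left_mono exp_minus_le) auto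
    then have "1 - q j + q j * exp (- (t * c j)) \<le> 1 + - (t * (q j * c j) / 2)"
      by (simp add: algebra_simps)
    also have "\<dots> \<le> exp (- (t * (q j * c j) / 2))" by (rule exp_ge_add_one_self)
    finally show "1 - q j + q j * exp (- (t * c j)) \<le> exp (- (t * (q j * c j) / 2))" .
  qed simp
  also have "\<dots> = exp (t * M / 4 + (\<Sum>j\<in>D. - (t * (q j * c j) / 2)))"
    using D by (simp add: exp_sum exp_add)
  also have "(\<Sum>j\<in>D. - (t * (q j * c j) / 2)) = - (t * M / 2)"
    unfolding M_def by (simp add: sum_negf sum_distrib_left sum_divide_distrib)
  finally show ?thesis by (simp add: mult.commute)
qed

end

section \<open>Single-spike and Bernoulli priors, and the choice between them\<close>

context sparse_model
begin

text \<open>The prior puts mass w j on the support {j}. Distinct singletons are disjoint, so only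
  the diagonal adds to the chi-square divergence, and no index of positive weight is bad.\<close>

lemma lower_bound_one_sparse:
  assumes w: "\<And>j. j \<in> {1..d} \<Longrightarrow> w j \<ge> 0" "(\<Sum>j=1..d. w j) = 1" and \<kappa>: "\<kappa> > 0"
    and chi: "(\<Sum>j=1..d. (w j)\<^sup>2 * (exp ((\<gamma> j)\<^sup>2) - 1)) \<le> \<kappa>\<^sup>2"
    and sep: "\<And>j. j \<in> {1..d} \<Longrightarrow> w j > 0 \<Longrightarrow> \<rho> \<le> \<sigma> * (\<bar>\<eta> j\<bar> * \<gamma> j)"
  shows "minimax_risk d s \<eta> \<sigma> t0 \<rho> \<ge> 1 - \<kappa>"
proof -
  have "minimax_risk d s \<eta> \<sigma> t0 \<rho> \<ge> 1 - \<kappa> - 0"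
  proof (rule lower_bound_prior[where I="{1..d}" and B="\<lambda>j. {j}" and w=w and \<gamma>=\<gamma>])
    have "(\<Sum>i=1..d. \<Sum>k=1..d. w i * w k * exp (\<Sum>j\<in>{i} \<inter> {k}. (\<gamma> j)\<^sup>2)) =
        (\<Sum>i=1..d. \<Sum>k=1..d. w i * w k + (if i = k then (w i)\<^sup>2 * (exp ((\<gamma> i)\<^sup>2) - 1) else 0))"
      by (intro sum.cong refl) (auto simp: power2_eq_square algebra_simps)
    also have "\<dots> = (\<Sum>i=1..d. w i) * (\<Sum>k=1..d. w k) + (\<Sum>i=1..d. (w i)\<^sup>2 * (exp ((\<gamma> i)\<^sup>2) - 1))"
      unfolding sum_product by (simp add: sum.distrib)
    finally show "(\<Sum>i=1..d. \<Sum>k=1..d. w i * w k * exp (\<Sum>j\<in>{i} \<inter> {k}. (\<gamma> j)\<^sup>2)) \<le> 1 + \<kappa>\<^sup>2"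
      using chi w(2) by simp
    show "(\<Sum>i\<in>{i \<in> {1..d}. \<not> (card {i} < s \<and> \<rho> \<le> \<sigma> * (\<Sum>j\<in>{i}. \<bar>\<eta> j\<bar> * \<gamma> j))}. w i) \<le> 0"
    proof (rule sum_nonpos)
      fix i assume i: "i \<in> {i \<in> {1..d}. \<not> (card {i} < s \<and> \<rho> \<le> \<sigma> * (\<Sum>j\<in>{i}. \<bar>\<eta> j\<bar> * \<gamma> j))}"
      then have "\<not> \<rho> \<le> \<sigma> * (\<bar>\<eta> i\<bar> * \<gamma> i)" using s_ge_2 by simp
      then have "\<not> w i > 0" using sep i by blast
      then show "w i \<le> 0" by simp
    qed
  qed (use w \<kappa> in auto)
  then show ?thesis by simp
qed

text \<open>Supports are drawn with inclusion probabilities (\<epsilon>/4) p. The budget \<epsilon>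
  is split into \<epsilon>/2 for the divergence, \<epsilon>/4 for supports with s or more elements
  and \<epsilon>/4 for supports with too small a value of L.\<close>

lemma lower_bound_bernoulli:
  assumes \<epsilon>: "0 < \<epsilon>" "\<epsilon> < 1"
    and \<gamma>: "\<And>j. j \<in> {1..d} \<Longrightarrow> \<gamma> j \<ge> 0"
    and chi: "(\<Sum>j=1..d. (p j)\<^sup>2 * (exp ((\<gamma> j)\<^sup>2) - 1)) \<le> 2 * (\<epsilon> / 4)\<^sup>2"
    and t: "t \<ge> 0" "\<And>j. j \<in> {1..d} \<Longrightarrow> t * (\<bar>\<eta> j\<bar> * \<gamma> j) \<le> 1"
    and M: "M = \<epsilon> / 4 * (\<Sum>j=1..d. p j * (\<bar>\<eta> j\<bar> * \<gamma> j))"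
    and tM: "ln (4 / \<epsilon>) \<le> t * M / 4"
    and sep: "\<rho> \<le> \<sigma> * (M / 4)"
  shows "minimax_risk d s \<eta> \<sigma> t0 \<rho> \<ge> 1 - \<epsilon>"
proof -
  define q where "q j = \<epsilon> / 4 * p j" for j
  interpret bernoulli_support "{1..d}" q
  proof
    fix j assume "j \<in> {1..d}"
    then show "0 \<le> q j \<and> q j \<le> 1"
      using p_nonneg[of j] p_le_1[of j] \<epsilon> mult_mono[of "\<epsilon> / 4" 1 "p j" 1] by (simp add: q_def)
  qed simp
  let ?D = "{1..d}"
  let ?c = "\<lambda>j. \<bar>\<eta> j\<bar> * \<gamma> j"
  have M': "M = (\<Sum>j\<in>?D. q j * ?c j)"
    by (simp add: M q_def sum_distrib_left mult_ac)
  have "minimax_risk d s \<eta> \<sigma> t0 \<rho> \<ge> 1 - \<epsilon> / 2 - \<epsilon> / 2"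
  proof (rule lower_bound_prior[where I="Pow ?D" and B="\<lambda>B. B" and w=wt and \<gamma>=\<gamma>])
    have "(\<Sum>j\<in>?D. (q j)\<^sup>2 * (exp ((\<gamma> j)\<^sup>2) - 1)) \<le> (\<Sum>j\<in>?D. (p j)\<^sup>2 * (exp ((\<gamma> j)\<^sup>2) - 1))"
    proof (intro sum_mono mult_right_mono power_mono)
      show "q j \<le> p j" "0 \<le> q j" for j
        using p_nonneg[of j] \<epsilon> mult_right_mono[of "\<epsilon> / 4" 1 "p j"] by (simp_all add: q_def)
    qed simp
    also note chi
    finally have le: "exp (\<Sum>j\<in>?D. (q j)\<^sup>2 * (exp ((\<gamma> j)\<^sup>2) - 1)) \<le> exp (2 * (\<epsilon> / 4)\<^sup>2)" by simp
    have "\<epsilon>\<^sup>2 \<le> 1" using \<epsilon> by (simp add: power_le_one)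
    \<comment> \<open>The bound 2 (\<epsilon>/4)^2 is what the linearised exponential turns into
      (\<epsilon>/2)^2.\<close>
    then have "exp (2 * (\<epsilon> / 4)\<^sup>2) \<le> 1 + 2 * (2 * (\<epsilon> / 4)\<^sup>2)"
      by (intro exp_le_1_plus_double) (auto simp: power_divide)
    also have "\<dots> = 1 + (\<epsilon> / 2)\<^sup>2" by (simp add: power_divide)
    finally show "(\<Sum>i\<in>Pow ?D. \<Sum>k\<in>Pow ?D. wt i * wt k * exp (\<Sum>j\<in>i \<inter> k. (\<gamma> j)\<^sup>2)) \<le> 1 + (\<epsilon> / 2)\<^sup>2"
      using wt_chi[of \<gamma>] le by linarith
    let ?bad = "{B \<in> Pow ?D. \<not> (card B < s \<and> \<rho> \<le> \<sigma> * (\<Sum>j\<in>B. ?c j))}"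
    let ?A = "{B \<in> Pow ?D. s \<le> card B}" and ?B = "{B \<in> Pow ?D. (\<Sum>j\<in>B. ?c j) < M / 4}"
    have "?bad \<subseteq> ?A \<union> ?B"
    proof
      fix B assume B: "B \<in> ?bad"
      show "B \<in> ?A \<union> ?B"
      proof (cases "s \<le> card B")
        case False
        then have "\<sigma> * (\<Sum>j\<in>B. ?c j) < \<sigma> * (M / 4)" using B sep by auto
        then have "(\<Sum>j\<in>B. ?c j) < M / 4" using \<sigma>_pos by simp
        then show ?thesis using B by blast
      qed (use B in auto)
    qed
    then have "(\<Sum>B\<in>?bad. wt B) \<le> (\<Sum>B\<in>?A \<union> ?B. wt B)"
      by (intro sum_mono2) (auto intro!: wt_nonneg simp del: One_nat_def)
    also have "\<dots> \<le> (\<Sum>B\<in>?A. wt B) + (\<Sum>B\<in>?B. wt B)"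
      by (subst sum_Un) (auto intro!: sum_nonneg wt_nonneg simp del: One_nat_def)
    also have "(\<Sum>B\<in>?B. wt B) \<le> exp (- (t * M / 4))"
      unfolding M' using t \<gamma> by (intro wt_lower_tail) auto
    also have "\<dots> \<le> exp (- ln (4 / \<epsilon>))" using tM by simp
    also have "\<dots> = \<epsilon> / 4" using \<epsilon> by (simp add: exp_minus)
    also have "(\<Sum>B\<in>?A. wt B) \<le> \<epsilon> / 4"
    proof -
      \<comment> \<open>K = 4/\<epsilon> undoes the thinning by \<epsilon>/4: the exponent stays
        below the sum of p, hence below s/2 by the equation for \<open>beta\<close>, while K^s in
        the denominator supplies (\<epsilon>/4)^s.\<close>
      have "(\<Sum>B\<in>?A. wt B) \<le> exp ((4 / \<epsilon> - 1) * (\<Sum>j\<in>?D. q j)) / (4 / \<epsilon>) ^ s"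
        using \<epsilon> by (intro wt_card_tail) simp
      also have "(4 / \<epsilon> - 1) * (\<Sum>j\<in>?D. q j) = (1 - \<epsilon> / 4) * (\<Sum>j\<in>?D. p j)"
        unfolding q_def sum_distrib_left[symmetric] using \<epsilon> by (simp add: field_simps)
      also have "(1 - \<epsilon> / 4) * (\<Sum>j\<in>?D. p j) \<le> 1 * (s / 2)"
        using \<epsilon> crit_lam_le p_nonneg unfolding sum_p[symmetric] by (intro mult_mono sum_nonneg) auto
      also have "1 * (real s / 2) = real s * (1 / 2)" by simp
      also have "exp (real s * (1 / 2)) / (4 / \<epsilon>) ^ s = (exp (1 / 2) * \<epsilon> / 4) ^ s"
        using \<epsilon> by (simp only: exp_of_nat_mult) (simp add: power_divide power_mult_distrib)
      also have "\<dots> \<le> (\<epsilon> / 2) ^ s"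
      proof (rule power_mono)
        have "exp (1 / 2 :: real) \<le> 2" using exp_le_1_plus_double[of "1 / 2"] by simp
        then show "exp (1 / 2) * \<epsilon> / 4 \<le> \<epsilon> / 2" using \<epsilon> by simp
      qed (use \<epsilon> in simp)
      also have "\<dots> \<le> (\<epsilon> / 2) ^ 2" using s_ge_2 \<epsilon> by (intro power_decreasing) auto
      also have "\<dots> \<le> \<epsilon> / 4" using \<epsilon> by (simp add: power2_eq_square)
      finally show ?thesis using \<epsilon> by (simp add: divide_right_mono)
    qed
    finally show "(\<Sum>B\<in>?bad. wt B) \<le> \<epsilon> / 2" by simp
  qed (use \<epsilon> sum_wt wt_nonneg in auto)
  then show ?thesis by simp
qed

text \<open>The larger part of the rate decides the shape of the spikes. Within each case a
  Bernoulli support is used if L concentrates; otherwise one spike reaches the rate up to a factor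
  of order X/\<epsilon>, which is why A is divided by the logarithm.\<close>

lemma lower_bound:
  assumes \<epsilon>: "0 < \<epsilon>" "\<epsilon> < 1" and A: "0 < A" "A \<le> \<epsilon>\<^sup>2 / (256 * ln (4 / \<epsilon>))"
  shows "minimax_risk d s \<eta> \<sigma> t0 (A * r_min d s \<eta> \<sigma>) \<ge> 1 - \<epsilon>"
proof -
  define X where "X = ln (4 / \<epsilon>)"
  have "exp 1 \<le> 4 / \<epsilon>"
  proof -
    have "exp 1 \<le> (4::real)" using e_less_272 by simp
    also have "4 \<le> 4 / \<epsilon>" using \<epsilon> by (simp add: le_divide_eq)
    finally show ?thesis .
  qed
  then have X: "X \<ge> 1" unfolding X_def using \<epsilon> by (simp add: ln_ge_iff)
  have AX: "256 * (A * X) \<le> \<epsilon>\<^sup>2"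
    using A(2) X by (simp add: X_def[symmetric] le_divide_eq mult_ac)
  have A1: "256 * A \<le> \<epsilon>\<^sup>2"
    using AX mult_left_mono[OF X, of A] A(1) by linarith
  have rho: "A * r_min d s \<eta> \<sigma> = \<sigma> * (A * rate)" by (simp add: r_min_eq)
  have \<epsilon>2: "(\<epsilon> / 4)\<^sup>2 \<le> 1" "0 \<le> (\<epsilon> / 4)\<^sup>2" using \<epsilon> by (auto simp: power_le_one)
  \<comment> \<open>The part \<open>\<lambda>\<^sub>o s\<close> of the rate calls for spikes proportional to \<open>1/|\<eta>\<^sub>j|\<close>, the part \<open>\<nu>\<close> for constant spikes.\<close>
  show ?thesis
  proof (cases "\<nu> \<le> lam * s")
    case True
    \<comment> \<open>A positive \<open>lam\<close> turns the bound s/2 on the sum of p into an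
      equality, which normalises the single-spike prior and fixes the mean M below.\<close>
    then have lam: "lam > 0" using nu_pos lam_nonneg by (cases "lam = 0") auto
    have sum_p_eq: "(\<Sum>j=1..d. p j) = s / 2" unfolding sum_p by (rule crit_lam[OF lam])
    have chi: "(\<Sum>j=1..d. (p j)\<^sup>2 * (exp ((a * lam / \<bar>\<eta> j\<bar>)\<^sup>2) - 1)) \<le> a\<^sup>2" if "a\<^sup>2 \<le> 1" for a
    proof -
      have "(\<Sum>j=1..d. (p j)\<^sup>2 * (exp ((a * lam / \<bar>\<eta> j\<bar>)\<^sup>2) - 1)) \<le> (\<Sum>j=1..d. a\<^sup>2 * ((p j)\<^sup>2 * exp (lam\<^sup>2 / (\<eta> j)\<^sup>2)))"
      proof (rule sum_mono)
        fix j
        have "exp ((a * lam / \<bar>\<eta> j\<bar>)\<^sup>2) - 1 = exp (a\<^sup>2 * (lam\<^sup>2 / (\<eta> j)\<^sup>2)) - 1"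
          by (simp add: power_divide power_mult_distrib)
        also have "\<dots> \<le> a\<^sup>2 * (exp (lam\<^sup>2 / (\<eta> j)\<^sup>2) - 1)"
          using that by (intro exp_scale_le) auto
        also have "\<dots> \<le> a\<^sup>2 * exp (lam\<^sup>2 / (\<eta> j)\<^sup>2)" by (intro mult_left_mono) auto
        finally have "(p j)\<^sup>2 * (exp ((a * lam / \<bar>\<eta> j\<bar>)\<^sup>2) - 1) \<le> (p j)\<^sup>2 * (a\<^sup>2 * exp (lam\<^sup>2 / (\<eta> j)\<^sup>2))"
          by (rule mult_left_mono) simp
        then show "(p j)\<^sup>2 * (exp ((a * lam / \<bar>\<eta> j\<bar>)\<^sup>2) - 1) \<le> a\<^sup>2 * ((p j)\<^sup>2 * exp (lam\<^sup>2 / (\<eta> j)\<^sup>2))"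
          by (simp add: mult_ac)
      qed
      also have "\<dots> = a\<^sup>2" by (simp only: sum_distrib_left[symmetric] sum_p_square mult_1_right)
      finally show ?thesis .
    qed
    have "rate \<le> 2 * (lam * s)" using True by linarith
    then have rate: "A * rate \<le> A * (2 * (lam * s))" using A(1) by (intro mult_left_mono) auto
    show ?thesis
    \<comment> \<open>With spikes (\<epsilon>/4) \<open>lam\<close> / |\<eta> j| one has M =
      \<epsilon>^2 \<open>lam\<close> s / 32 and may take t = 4 / (\<epsilon> \<open>lam\<close>),
      so t M / 4 = \<epsilon> s / 32 reaches X at this value of s.\<close>
    proof (cases "real s \<le> 32 * X / \<epsilon>")
      case True
      show ?thesis
      \<comment> \<open>Every spike adds the same amount \<sigma> \<epsilon> \<open>lam\<close> to L
        wherever it sits, and 2/s <= 1 keeps the divergence below the one computed for p.\<close>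
      proof (rule lower_bound_one_sparse[where w="\<lambda>j. 2 / s * p j" and \<gamma>="\<lambda>j. \<epsilon> * lam / \<bar>\<eta> j\<bar>"])
        show "(\<Sum>j=1..d. 2 / s * p j) = 1"
          unfolding sum_distrib_left[symmetric] sum_p_eq using s_ge_2 by simp
        have "(\<Sum>j=1..d. (2 / s * p j)\<^sup>2 * (exp ((\<epsilon> * lam / \<bar>\<eta> j\<bar>)\<^sup>2) - 1)) \<le>
            (\<Sum>j=1..d. (p j)\<^sup>2 * (exp ((\<epsilon> * lam / \<bar>\<eta> j\<bar>)\<^sup>2) - 1))"
        proof (intro sum_mono mult_right_mono power_mono)
          show "2 / real s * p j \<le> p j" for j
            using s_ge_2 p_nonneg[of j] by (intro mult_left_le_one_le) auto
        qed (auto simp: p_nonneg)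
        also have "\<dots> \<le> \<epsilon>\<^sup>2" using \<epsilon> by (intro chi) (simp add: power_le_one)
        finally show "(\<Sum>j=1..d. (2 / s * p j)\<^sup>2 * (exp ((\<epsilon> * lam / \<bar>\<eta> j\<bar>)\<^sup>2) - 1)) \<le> \<epsilon>\<^sup>2" .
        show "A * r_min d s \<eta> \<sigma> \<le> \<sigma> * (\<bar>\<eta> j\<bar> * (\<epsilon> * lam / \<bar>\<eta> j\<bar>))" if j: "j \<in> {1..d}" for j
        proof -
          have "A * (2 * (lam * s)) \<le> A * (2 * (lam * (32 * X / \<epsilon>)))"
            using True A(1) lam by (intro mult_left_mono) auto
          also have "\<dots> = 64 * (A * X) * lam / \<epsilon>" by simp
          also have "\<dots> \<le> \<epsilon>\<^sup>2 * lam / \<epsilon>"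
          proof (intro divide_right_mono mult_right_mono)
            have "0 \<le> A * X" using A(1) X by simp
            then show "64 * (A * X) \<le> \<epsilon>\<^sup>2" using AX by linarith
          qed (use lam \<epsilon> in auto)
          also have "\<dots> = \<epsilon> * lam" using \<epsilon> by (simp add: power2_eq_square)
          finally have "A * rate \<le> \<epsilon> * lam" using rate by linarith
          then show ?thesis unfolding rho using \<sigma>_pos \<eta>_nonzero[OF j] by simp
        qed
      qed (use \<epsilon> p_nonneg in auto)
    next
      case False
      have c: "\<bar>\<eta> j\<bar> * (\<epsilon> / 4 * lam / \<bar>\<eta> j\<bar>) = \<epsilon> / 4 * lam" if "j \<in> {1..d}" for j
        using \<eta>_nonzero[OF that] by simp
      have "\<epsilon> / 4 * (\<Sum>j=1..d. p j * (\<bar>\<eta> j\<bar> * (\<epsilon> / 4 * lam / \<bar>\<eta> j\<bar>))) = \<epsilon> / 4 * (\<Sum>j=1..d. p j * (\<epsilon> / 4 * lam))"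
        by (simp only: c cong: sum.cong)
      also have "\<dots> = \<epsilon>\<^sup>2 * lam * s / 32"
        unfolding sum_distrib_right[symmetric] sum_p_eq by (simp add: power2_eq_square)
      finally have M: "\<epsilon>\<^sup>2 * lam * s / 32 = \<epsilon> / 4 * (\<Sum>j=1..d. p j * (\<bar>\<eta> j\<bar> * (\<epsilon> / 4 * lam / \<bar>\<eta> j\<bar>)))" ..
      show ?thesis
      proof (rule lower_bound_bernoulli[where \<gamma>="\<lambda>j. \<epsilon> / 4 * lam / \<bar>\<eta> j\<bar>" and t="1 / (\<epsilon> / 4 * lam)", OF \<epsilon> _ _ _ _ M])
        show "(\<Sum>j=1..d. (p j)\<^sup>2 * (exp ((\<epsilon> / 4 * lam / \<bar>\<eta> j\<bar>)\<^sup>2) - 1)) \<le> 2 * (\<epsilon> / 4)\<^sup>2"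
          using chi[OF \<epsilon>2(1)] \<epsilon>2(2) by linarith
        show "1 / (\<epsilon> / 4 * lam) * (\<bar>\<eta> j\<bar> * (\<epsilon> / 4 * lam / \<bar>\<eta> j\<bar>)) \<le> 1" if "j \<in> {1..d}" for j
          unfolding c[OF that] using \<epsilon> lam by simp
        have "32 * X \<le> \<epsilon> * s" using False \<epsilon> by (simp add: field_simps)
        then show "ln (4 / \<epsilon>) \<le> 1 / (\<epsilon> / 4 * lam) * (\<epsilon>\<^sup>2 * lam * s / 32) / 4"
          unfolding X_def[symmetric] using \<epsilon> lam by (simp add: field_simps power2_eq_square)
        have "A * (2 * (lam * s)) \<le> \<epsilon>\<^sup>2 / 256 * (2 * (lam * s))"
          using A1 lam by (intro mult_right_mono) auto
        also have "\<dots> = \<epsilon>\<^sup>2 * lam * s / 32 / 4" by simp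
        finally have "A * rate \<le> \<epsilon>\<^sup>2 * lam * s / 32 / 4" using rate by linarith
        then show "A * r_min d s \<eta> \<sigma> \<le> \<sigma> * (\<epsilon>\<^sup>2 * lam * s / 32 / 4)"
          unfolding rho using \<sigma>_pos by (intro mult_left_mono) auto
      qed (use \<epsilon> lam in auto)
    qed
  next
    case False
    then have rate: "A * rate \<le> A * (2 * \<nu>)" using A(1) by (intro mult_left_mono) auto
    \<comment> \<open>Chosen so that t = 4 / (\<tau> \<nu> \<epsilon>) and M = \<epsilon>^2 \<nu> /
      16 give t M / 4 = X exactly in the Bernoulli case.\<close>
    define \<tau> where "\<tau> = \<epsilon> / (16 * X)"
    have \<tau>: "\<tau> > 0" using \<epsilon> X by (simp add: \<tau>_def)
    show ?thesis
    proof (cases "\<tau> * \<nu> \<le> \<bar>\<eta> 1\<bar>")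
      case True
      show ?thesis
      \<comment> \<open>The first coordinate alone carries a fraction \<tau> of \<nu>, so a
        deterministic spike of size \<sigma> \<epsilon>/2 there suffices.\<close>
      proof (rule lower_bound_one_sparse[where w="\<lambda>j. if j = 1 then 1 else 0" and \<gamma>="\<lambda>j. \<epsilon> / 2"])
        show "(\<Sum>j=1..d. if j = 1 then 1 else 0) = (1::real)" using one_mem by simp
        have "(\<Sum>j=1..d. (if j = 1 then 1 else 0)\<^sup>2 * (exp ((\<epsilon> / 2)\<^sup>2) - 1)) =
            (\<Sum>j=1..d. if j = 1 then exp ((\<epsilon> / 2)\<^sup>2) - 1 else 0)"
          by (intro sum.cong) auto
        also have "\<dots> = exp ((\<epsilon> / 2)\<^sup>2) - 1" using one_mem by simp
        also have "\<dots> \<le> 2 * (\<epsilon> / 2)\<^sup>2"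
          using exp_le_1_plus_double[of "(\<epsilon> / 2)\<^sup>2"] \<epsilon> by (simp add: power_le_one)
        also have "\<dots> \<le> \<epsilon>\<^sup>2" by (simp add: power_divide)
        finally show "(\<Sum>j=1..d. (if j = 1 then 1 else 0)\<^sup>2 * (exp ((\<epsilon> / 2)\<^sup>2) - 1)) \<le> \<epsilon>\<^sup>2" .
        fix j :: nat assume "(if j = 1 then 1 else 0) > (0::real)"
        then have j: "j = 1" by (simp split: if_splits)
        have "A * (2 * \<nu>) = A * X * (32 / \<epsilon>) * (\<tau> * \<nu>)" using \<epsilon> X by (simp add: \<tau>_def)
        also have "\<dots> \<le> \<epsilon>\<^sup>2 / 256 * (32 / \<epsilon>) * \<bar>\<eta> 1\<bar>"
          using AX True \<epsilon> \<tau> nu_pos by (intro mult_mono mult_right_mono) auto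
        also have "\<dots> = \<bar>\<eta> 1\<bar> * (\<epsilon> / 8)" using \<epsilon> by (simp add: power2_eq_square)
        also have "\<dots> \<le> \<bar>\<eta> 1\<bar> * (\<epsilon> / 2)" using \<epsilon> by (intro mult_left_mono) auto
        finally have "A * rate \<le> \<bar>\<eta> 1\<bar> * (\<epsilon> / 2)" using rate by linarith
        then show "A * r_min d s \<eta> \<sigma> \<le> \<sigma> * (\<bar>\<eta> j\<bar> * (\<epsilon> / 2))"
          unfolding rho j using \<sigma>_pos by (intro mult_left_mono) auto
      qed (use \<epsilon> in auto)
    next
      case False
      have "\<epsilon> / 4 * (\<Sum>j=1..d. p j * (\<bar>\<eta> j\<bar> * (\<epsilon> / 4))) = \<epsilon> / 4 * ((\<Sum>j=1..d. p j * \<bar>\<eta> j\<bar>) * (\<epsilon> / 4))"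
        unfolding sum_distrib_right by (simp only: mult.assoc)
      also have "\<dots> = \<epsilon>\<^sup>2 * \<nu> / 16" unfolding sum_p_abs by (simp add: power2_eq_square)
      finally have M: "\<epsilon>\<^sup>2 * \<nu> / 16 = \<epsilon> / 4 * (\<Sum>j=1..d. p j * (\<bar>\<eta> j\<bar> * (\<epsilon> / 4)))" ..
      show ?thesis
      proof (rule lower_bound_bernoulli[where \<gamma>="\<lambda>j. \<epsilon> / 4" and t="1 / (\<tau> * \<nu> * (\<epsilon> / 4))", OF \<epsilon> _ _ _ _ M])
        have ex: "0 \<le> exp ((\<epsilon> / 4)\<^sup>2) - 1" "exp ((\<epsilon> / 4)\<^sup>2) - 1 \<le> 2 * (\<epsilon> / 4)\<^sup>2"
          using exp_le_1_plus_double[OF \<epsilon>2(2,1)] by auto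
        have "(\<Sum>j=1..d. (p j)\<^sup>2 * (exp ((\<epsilon> / 4)\<^sup>2) - 1)) \<le> 1 * (2 * (\<epsilon> / 4)\<^sup>2)"
          unfolding sum_distrib_right[symmetric] using ex sum_p_square_le by (intro mult_mono) auto
        then show "(\<Sum>j=1..d. (p j)\<^sup>2 * (exp ((\<epsilon> / 4)\<^sup>2) - 1)) \<le> 2 * (\<epsilon> / 4)\<^sup>2" by simp
        show "1 / (\<tau> * \<nu> * (\<epsilon> / 4)) * (\<bar>\<eta> j\<bar> * (\<epsilon> / 4)) \<le> 1" if j: "j \<in> {1..d}" for j
        proof -
          have "\<bar>\<eta> j\<bar> \<le> \<bar>\<eta> 1\<bar>" using adm j one_mem by (auto simp: admissible_def)
          \<comment> \<open>All coordinates are small compared with \<nu>, which is the boundedness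
            required by the exponential moment bound.\<close>
          then have "\<bar>\<eta> j\<bar> \<le> \<tau> * \<nu>" using False by linarith
          then have "\<bar>\<eta> j\<bar> / (\<tau> * \<nu>) \<le> 1" using \<tau> nu_pos by simp
          then show ?thesis using \<epsilon> by simp
        qed
        show "ln (4 / \<epsilon>) \<le> 1 / (\<tau> * \<nu> * (\<epsilon> / 4)) * (\<epsilon>\<^sup>2 * \<nu> / 16) / 4"
          unfolding X_def[symmetric] \<tau>_def using \<epsilon> X nu_pos by (simp add: power2_eq_square)
        have "A * (2 * \<nu>) \<le> \<epsilon>\<^sup>2 / 256 * (2 * \<nu>)"
          using A1 nu_pos by (intro mult_right_mono) auto
        also have "\<dots> \<le> \<epsilon>\<^sup>2 * \<nu> / 16 / 4" using nu_pos by (simp add: mult_ac)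
        finally have "A * rate \<le> \<epsilon>\<^sup>2 * \<nu> / 16 / 4" using rate by linarith
        then show "A * r_min d s \<eta> \<sigma> \<le> \<sigma> * (\<epsilon>\<^sup>2 * \<nu> / 16 / 4)"
          unfolding rho using \<sigma>_pos by (intro mult_left_mono) auto
      qed (use \<epsilon> \<tau> nu_pos in auto)
    qed
  qed
qed

end

theorem theorem8:
  fixes \<epsilon> :: real
  assumes "0 < \<epsilon>" and "\<epsilon> < 1"
  shows "(\<exists>A\<^sub>\<epsilon>>0. \<forall>(d::nat) (s::nat) (\<eta>::nat \<Rightarrow> real) (\<sigma>::real) (t0::real).
            admissible d s \<eta> \<sigma> \<longrightarrow>
            (\<forall>A>A\<^sub>\<epsilon>. minimax_risk d s \<eta> \<sigma> t0 (A * r_min d s \<eta> \<sigma>) \<le> \<epsilon>)) \<and>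
         (\<exists>a\<^sub>\<epsilon>>0. \<forall>(d::nat) (s::nat) (\<eta>::nat \<Rightarrow> real) (\<sigma>::real) (t0::real).
            admissible d s \<eta> \<sigma> \<longrightarrow>
            (\<forall>A. 0 < A \<and> A < a\<^sub>\<epsilon> \<longrightarrow>
               minimax_risk d s \<eta> \<sigma> t0 (A * r_min d s \<eta> \<sigma>) \<ge> 1 - \<epsilon>))"
proof (intro conjI exI allI impI)
  \<comment> \<open>14^2 = 196 >= 192 makes the bound 192 / A^2 at most \<epsilon>^2, and 14 /
    \<epsilon> > 8 since \<epsilon> < 1.\<close>
  show "14 / \<epsilon> > 0" using assms by simp
  fix d s :: nat and \<eta> :: "nat \<Rightarrow> real" and \<sigma> t0 A :: real
  assume adm: "admissible d s \<eta> \<sigma>" and A: "14 / \<epsilon> < A"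
  interpret sparse_model d s \<eta> \<sigma> by standard (rule adm)
  have "14 \<le> 14 / \<epsilon>" using assms by (simp add: le_divide_eq)
  then have A8: "A \<ge> 8" using A by linarith
  have "192 / A\<^sup>2 \<le> 192 / (14 / \<epsilon>)\<^sup>2"
    using A assms by (intro divide_left_mono power_mono mult_pos_pos) auto
  also have "\<dots> \<le> \<epsilon> * \<epsilon>" by (simp add: power2_eq_square)
  also have "\<dots> \<le> \<epsilon> * 1" using assms by (intro mult_left_mono) auto
  finally show "minimax_risk d s \<eta> \<sigma> t0 (A * r_min d s \<eta> \<sigma>) \<le> \<epsilon>"
    using upper_bound[OF A8, of t0] by linarith
next
  have "ln (4 / \<epsilon>) > 0" using assms by simp
  then show "\<epsilon>\<^sup>2 / (256 * ln (4 / \<epsilon>)) > 0" using assms by simp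
  fix d s :: nat and \<eta> :: "nat \<Rightarrow> real" and \<sigma> t0 A :: real
  assume adm: "admissible d s \<eta> \<sigma>" and A: "0 < A \<and> A < \<epsilon>\<^sup>2 / (256 * ln (4 / \<epsilon>))"
  interpret sparse_model d s \<eta> \<sigma> by standard (rule adm)
  show "1 - \<epsilon> \<le> minimax_risk d s \<eta> \<sigma> t0 (A * r_min d s \<eta> \<sigma>)"
    using A by (intro lower_bound assms) auto
qed

end
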